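(* Let $3\le n<\omega$. Then the Borel space of generalised $n$-gons with domain $\omega$ is Borel complete.
   Context: A generalised $n$-gon is a bipartite graph (with sorts called points and lines, and edge relation called incidence) of girth $2n$ and diameter $n$. Generalised $n$-gons with domain $\omega$ are viewed as countable structures in the two-sorted language of points, lines and incidence, forming a standard Borel space (a Borel subset of the Polish space of such structures on $\omega$). A class of countable structures with domain $\omega$ is Borel complete if the isomorphism relation on countable graphs (with domain $\omega$) Borel reduces to the isomorphism relation on that class, i.e. there is a Borel map $f$ from graphs to members of the class with $G\cong H$ iff $f(G)\cong f(H)$. *)

theory Defs
  imports "HOL-Analysis.Analysis" "HOL-Library.Extended_Nat"
begin

(* Distances are least lengths of walks, the girth is the least length of a cycle; in enat the
   infimum of the empty set is infinite, so a disconnected graph has infinite diameter and a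
   forest has infinite girth. *)

definition walks :: "('a \<Rightarrow> 'a \<Rightarrow> bool) \<Rightarrow> 'a \<Rightarrow> 'a \<Rightarrow> 'a list set" where
  "walks E x y = {xs. xs \<noteq> [] \<and> hd xs = x \<and> last xs = y \<and> successively E xs}"

definition graph_dist :: "('a \<Rightarrow> 'a \<Rightarrow> bool) \<Rightarrow> 'a \<Rightarrow> 'a \<Rightarrow> enat" where
  "graph_dist E x y = (INF xs \<in> walks E x y. enat (length xs - 1))"

definition graph_diameter :: "('a \<Rightarrow> 'a \<Rightarrow> bool) \<Rightarrow> enat" where
  "graph_diameter E = (SUP (x, y) \<in> UNIV. graph_dist E x y)"

definition cycles :: "('a \<Rightarrow> 'a \<Rightarrow> bool) \<Rightarrow> 'a list set" where
  "cycles E = {xs. 3 \<le> length xs \<and> distinct xs \<and> successively E xs \<and> E (last xs) (hd xs)}"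

definition graph_girth :: "('a \<Rightarrow> 'a \<Rightarrow> bool) \<Rightarrow> enat" where
  "graph_girth E = (INF xs \<in> cycles E. enat (length xs))"

definition graphs :: "(nat \<Rightarrow> nat \<Rightarrow> bool) set" where
  "graphs = {E. symp E \<and> irreflp E}"

definition graph_iso :: "(nat \<Rightarrow> nat \<Rightarrow> bool) \<Rightarrow> (nat \<Rightarrow> nat \<Rightarrow> bool) \<Rightarrow> bool" where
  "graph_iso G H \<longleftrightarrow> (\<exists>\<pi>. bij \<pi> \<and> (\<forall>x y. G x y \<longleftrightarrow> H (\<pi> x) (\<pi> y)))"

(* (P, L, I): the set of points, the set of lines and the incidence relation of a structure with
   domain nat.  The topology of this type is the product topology, i.e. that of
   2^\<nat> \<times> 2^\<nat> \<times> 2^(\<nat> \<times> \<nat>). *)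

type_synonym geometry = "(nat \<Rightarrow> bool) \<times> (nat \<Rightarrow> bool) \<times> (nat \<Rightarrow> nat \<Rightarrow> bool)"

definition generalised_polygons :: "nat \<Rightarrow> geometry set" where
  "generalised_polygons n =
     {(P, L, I). (\<forall>x. P x \<longleftrightarrow> \<not> L x) \<and> symp I \<and>
        (\<forall>x y. I x y \<longrightarrow> (P x \<and> L y) \<or> (L x \<and> P y)) \<and>
        graph_girth I = enat (2 * n) \<and> graph_diameter I = enat n}"

(* isomorphisms preserve the sorts: dualities are not isomorphisms *)

definition geometry_iso :: "geometry \<Rightarrow> geometry \<Rightarrow> bool" where
  "geometry_iso = (\<lambda>(P, L, I) (P', L', I').
     \<exists>\<pi>. bij \<pi> \<and> (\<forall>x. P x \<longleftrightarrow> P' (\<pi> x)) \<and> (\<forall>x. L x \<longleftrightarrow> L' (\<pi> x)) \<and>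
        (\<forall>x y. I x y \<longleftrightarrow> I' (\<pi> x) (\<pi> y)))"

definition borel_reducible ::
  "'a::topological_space set \<Rightarrow> ('a \<Rightarrow> 'a \<Rightarrow> bool) \<Rightarrow>
   'b::topological_space set \<Rightarrow> ('b \<Rightarrow> 'b \<Rightarrow> bool) \<Rightarrow> bool" where
  "borel_reducible X R Y S \<longleftrightarrow>
     (\<exists>f \<in> restrict_space borel X \<rightarrow>\<^sub>M restrict_space borel Y.
        \<forall>x\<in>X. \<forall>y\<in>X. R x y \<longleftrightarrow> S (f x) (f y))"

definition borel_complete ::
  "'a::topological_space set \<Rightarrow> ('a \<Rightarrow> 'a \<Rightarrow> bool) \<Rightarrow> bool" where
  "borel_complete K R \<longleftrightarrow> borel_reducible graphs graph_iso K R"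

lemma INF_enat_le_iff:
  "(INF x \<in> A. enat (f x)) \<le> enat k \<longleftrightarrow> (\<exists>x \<in> A. f x \<le> k)"
proof
  assume le: "(INF x \<in> A. enat (f x)) \<le> enat k"
  then have "A \<noteq> {}"
    by (auto simp: top_enat_def)
  then have "(INF x \<in> A. enat (f x)) \<in> (\<lambda>x. enat (f x)) ` A"
    by (auto intro: wellorder_InfI)
  with le show "\<exists>x \<in> A. f x \<le> k"
    by auto
next
  assume "\<exists>x \<in> A. f x \<le> k"
  then show "(INF x \<in> A. enat (f x)) \<le> enat k"
    by (meson INF_lower2 enat_ord_simps(1))
qed

lemma eq_enat_iff: "(a :: enat) = enat m \<longleftrightarrow> a \<le> enat m \<and> (\<forall>k<m. \<not> a \<le> enat k)"
  by (cases a) (simp_all, metis le_antisym order_refl not_le)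

lemma graph_girth_le_iff:
  "graph_girth E \<le> enat k \<longleftrightarrow>
     (\<exists>xs. 3 \<le> length xs \<and> distinct xs \<and> successively E xs \<and> E (last xs) (hd xs) \<and> length xs \<le> k)"
  unfolding graph_girth_def INF_enat_le_iff by (auto simp: cycles_def)

lemma graph_diameter_le_iff:
  "graph_diameter E \<le> enat k \<longleftrightarrow>
     (\<forall>x y. \<exists>xs. xs \<noteq> [] \<and> hd xs = x \<and> last xs = y \<and> successively E xs \<and> length xs - 1 \<le> k)"
  unfolding graph_diameter_def SUP_le_iff
  by (auto simp: graph_dist_def INF_enat_le_iff walks_def)

lemma generalised_polygons_borel: "generalised_polygons n \<in> sets borel"
proof -
  have pred: "Measurable.pred borel g" if "continuous_on UNIV g" for g :: "geometry \<Rightarrow> bool"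
    using open_vimage[OF open_discrete that, of "{True}"]
    by (simp add: pred_def vimage_def borel_open)
  note coord = continuous_on_product_then_coordinatewise
  have P [measurable]: "Measurable.pred borel (\<lambda>S :: geometry. fst S x)" for x
    by (rule pred, rule coord[where f = fst]) (intro continuous_intros)
  have L [measurable]: "Measurable.pred borel (\<lambda>S :: geometry. fst (snd S) x)" for x
    by (rule pred, rule coord[where f = "\<lambda>S. fst (snd S)"]) (intro continuous_intros)
  have I [measurable]: "Measurable.pred borel (\<lambda>S :: geometry. snd (snd S) x y)" for x y
    by (rule pred, rule coord[OF coord[where f = "\<lambda>S. snd (snd S)"]]) (intro continuous_intros)
  have walk [measurable]:
    "Measurable.pred borel (\<lambda>S :: geometry. successively (snd (snd S)) xs)" for xs
    by (induction xs rule: induct_list012) (simp_all, measurable)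
  have "Measurable.pred borel (\<lambda>S. S \<in> generalised_polygons n)"
    unfolding generalised_polygons_def eq_enat_iff graph_girth_le_iff graph_diameter_le_iff
      symp_def case_prod_unfold mem_Collect_eq
    by measurable
  then show ?thesis
    by (simp add: pred_def)
qed

end

(* Code a graph G by a partial linear space in which every flag lies in a finite subspace with at
   least three lines on each point and three points on each line: for each ordered pair (u, v) take
   a Fano plane, and for each vertex w a point Hub w lying on one line of every plane (w, v), and on
   a second line of the plane (u, w) whenever u and w are adjacent in G.  Replacing each flag by a
   path of length n - 2 turns the incidence graph, whose girth is at least 6, into a bipartite
   graph of girth at least 6 (n - 2) >= 2 n.  Its free completion, obtained by repeatedly joining
   all pairs of vertices of the right parity at distance greater than n - 1 by new paths of length
   n - 1, is a generalised n-gon.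

   In the free completion a finite subgraph of minimal degree 2 which meets the new vertices
   contains, at the last stage it meets, an entire new path, hence a chain of n - 2 vertices of
   degree 2.  So the base is the union of the finite subgraphs of minimal degree 2 without such
   chains, and is recovered from the isomorphism type.  In the base the hubs are the vertices of
   infinite degree, and two of them are adjacent in G iff they are joined by a walk of length at
   most 4 (n - 2). *)

theory Submission
  imports Defs
begin

section \<open>Walks and cycles\<close>

text \<open>The two lengths are chosen against each other: a new path of length n - 1 has n - 2
  interior vertices, a subdivided flag of length n - 2 only n - 3. This difference of one vertex
  separates base and completion, once three neighbours at each point and line of a finite subspace
  keep chains of degree 2 inside a single flag. Parity carries the girth through the stages. A walk
  of the right parity that is longer than n - 1 has length at least n + 1, which is what closes a
  new path to a cycle of length at least 2 n. Planes are attached to all ordered pairs, adjacent or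
  not, so that a hub has infinite degree even at an isolated vertex of G; the edges of G only add
  incidences. The geometry must depend on G in a Borel way. Therefore all vertices are terms of one
  countable type, and both the orientation of the new paths and the numbering of the vertices are
  read off from codes. Neither choice is invariant under isomorphism, so a map between bases has to
  be lifted with corrections.\<close>

lemma path_relpowp:
  fixes R :: "'a \<Rightarrow> 'a \<Rightarrow> bool"
  assumes "\<And>i. i < m \<Longrightarrow> R (f i) (f (Suc i))"
  shows "(R ^^ m) (f 0) (f m)"
  using assms by (induction m) auto

lemma relpowp_map:
  fixes R :: "'a \<Rightarrow> 'a \<Rightarrow> bool" and S :: "'b \<Rightarrow> 'b \<Rightarrow> bool"
  assumes "(R ^^ m) x y" "\<And>x y. R x y \<Longrightarrow> S (f x) (f y)"
  shows "(S ^^ m) (f x) (f y)"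
  using assms by (induction m arbitrary: y) auto

lemma relpowp_sym:
  fixes R :: "'a \<Rightarrow> 'a \<Rightarrow> bool"
  assumes "(R ^^ m) x y" "\<And>x y. R x y \<Longrightarrow> R y x"
  shows "(R ^^ m) y x"
  using assms(1)
proof (induction m arbitrary: y)
  case (Suc m)
  then obtain z where "(R ^^ m) z x" "R z y"
    by (meson relpowp_Suc_E)
  with assms(2) show ?case
    by (meson relpowp_Suc_I2)
qed simp

text \<open>A vertex prepended to a path on which it already occurs replaces everything before that
  occurrence.\<close>

lemma relpowp_imp_path:
  assumes "(E ^^ m) x y"
  shows "\<exists>xs. xs \<noteq> [] \<and> hd xs = x \<and> last xs = y \<and> successively E xs \<and> distinct xs \<and> length xs \<le> Suc m"
  using assms
proof (induction m arbitrary: x)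
  case 0
  then show ?case by (intro exI[of _ "[x]"]) auto
next
  case (Suc m)
  then obtain z where z: "E x z" "(E ^^ m) z y"
    by (meson relpowp_Suc_D2)
  from Suc.IH[OF z(2)] obtain xs where xs: "xs \<noteq> []" "hd xs = z" "last xs = y"
    "successively E xs" "distinct xs" "length xs \<le> Suc m" by blast
  show ?case
  proof (cases "x \<in> set xs")
    case True
    then obtain as bs where "xs = as @ x # bs" by (meson split_list)
    with xs show ?thesis
      by (intro exI[of _ "x # bs"]) (auto simp: successively_append_iff)
  next
    case False
    with xs z show ?thesis
      by (intro exI[of _ "x # xs"]) (auto simp: successively_Cons)
  qed
qed

lemma walk_imp_relpowp:
  assumes "successively E xs" "xs \<noteq> []"
  shows "(E ^^ (length xs - 1)) (hd xs) (last xs)"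
  using assms
proof (induction xs)
  case (Cons a xs)
  then show ?case
    by (cases "xs = []") (auto simp: successively_Cons simp del: relpowp.simps(2) intro: relpowp_Suc_I2 dest!: iffD2[OF length_greater_0_conv] gr0_implies_Suc)
qed simp

text \<open>Once the common beginning is removed, the paths leave \<open>a\<close> by different
  vertices. The cycle follows \<open>p\<close> up to its first vertex \<open>z\<close> on
  \<open>q\<close> and returns along \<open>q\<close>; \<open>a\<close> and \<open>z\<close> are
  counted in both paths, whence the 2.\<close>

lemma two_paths_imp_cycle:
  assumes "symp E" "distinct p" "distinct q" "successively E p" "successively E q"
    "p \<noteq> []" "q \<noteq> []" "hd p = hd q" "last p = last q" "p \<noteq> q"
  shows "\<exists>xs \<in> cycles E. length xs + 2 \<le> length p + length q"
  using assms(2-)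
proof (induction p arbitrary: q)
  case (Cons a p')
  then obtain q' where q: "q = a # q'"
    by (metis list.collapse list.sel(1))
  have ne: "p' \<noteq> []" "q' \<noteq> []"
    using Cons.prems unfolding q by (auto split: if_splits)
  show ?case
  proof (cases "hd p' = hd q'")
    case True
    with Cons.prems ne have "\<exists>xs \<in> cycles E. length xs + 2 \<le> length p' + length q'"
      unfolding q by (intro Cons.IH) (auto simp: successively_Cons)
    then show ?thesis
      unfolding q by force
  next
    case False
    have "last p' \<in> set p' \<and> last p' \<in> set q'"
      using Cons.prems ne unfolding q by (metis last_ConsR last_in_set)
    then obtain p1 z p2 where p': "p' = p1 @ z # p2" and zq: "z \<in> set q'" and p1: "\<forall>w \<in> set p1. w \<notin> set q'"
      using split_list_first_prop[of p' "\<lambda>w. w \<in> set q'"] by blast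
    obtain q1 q2 where q': "q' = q1 @ z # q2"
      using zq by (meson split_list)
    have sym: "E x y \<Longrightarrow> E y x" for x y
      using assms(1) by (auto dest: sympD)
    have succ_q: "successively E (q1 @ [z])" "E a (hd (q1 @ [z]))"
      using Cons.prems ne unfolding q q'
      by (auto simp: successively_append_iff successively_Cons hd_append split: if_splits)
    have "(\<lambda>x y. E y x) = E"
      using sym by blast
    then have rev: "successively E (z # rev q1)"
      using successively_rev[of E "q1 @ [z]"] succ_q(1) by (simp only: rev_append rev.simps append.simps)
    let ?xs = "a # p1 @ z # rev q1"
    \<comment> \<open>The arcs between \<open>a\<close> and \<open>z\<close> are not both empty:
      otherwise \<open>p'\<close> and \<open>q'\<close> would both begin with
      \<open>z\<close>.\<close>
    have "3 \<le> length ?xs"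
      using False unfolding p' q' by (cases p1; cases q1) auto
    moreover have "distinct ?xs"
      using Cons.prems p1 unfolding p' q q' by auto
    moreover have "successively E ?xs"
      using rev Cons.prems successively_append_iff[of E "a # p1" "z # p2"]
        successively_append_iff[of E "a # p1" "z # rev q1"]
      unfolding p' by (simp del: successively.simps)
    moreover have "last ?xs = hd (q1 @ [z])"
      by (cases q1) auto
    then have "E (last ?xs) (hd ?xs)"
      using sym[OF succ_q(2)] by simp
    ultimately have "?xs \<in> cycles E"
      unfolding cycles_def by blast
    then show ?thesis
      by (rule bexI[rotated]) (simp add: q p' q')
  qed
qed simp

text \<open>A path is prolonged at its first vertex by a neighbour other than the second one; a
  repetition would close a cycle with fewer than \<open>g\<close> vertices.\<close>

lemma long_path_exists:
  assumes irrefl: "\<And>x. \<not> E x x" and "symp E"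
    and deg: "\<And>x. \<exists>a b. a \<noteq> b \<and> E x a \<and> E x b"
    and cyc: "\<And>xs. xs \<in> cycles E \<Longrightarrow> g \<le> length xs"
    and "k < g"
  shows "\<exists>xs. length xs = Suc k \<and> distinct xs \<and> successively E xs"
  using \<open>k < g\<close>
proof (induction k)
  case 0
  show ?case by (rule exI[of _ "[undefined]"]) simp
next
  case (Suc k)
  then obtain a ys where xs: "length (a # ys) = Suc k" "distinct (a # ys)" "successively E (a # ys)"
    by (metis Suc_lessD length_Suc_conv)
  obtain z where z: "E a z" "ys \<noteq> [] \<Longrightarrow> z \<noteq> hd ys"
    using deg[of a] by metis
  have za: "E z a"
    using z(1) \<open>symp E\<close> by (auto dest: sympD)
  have "z \<notin> set (a # ys)"
  proof
    assume "z \<in> set (a # ys)"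
    then have "z \<in> set ys"
      using z irrefl by auto
    then obtain as bs where ys: "ys = as @ z # bs"
      by (meson split_list)
    have "as \<noteq> []"
      using z(2) ys by auto
    moreover have "hd (as @ z # bs) = hd (as @ [z])"
      by (cases as) auto
    ultimately have "a # as @ [z] \<in> cycles E"
      using xs za unfolding ys cycles_def
      by (auto simp: Suc_le_eq simp: successively_append_iff successively_Cons split: if_splits)
    from cyc[OF this] xs(1) Suc.prems show False
      unfolding ys by simp
  qed
  with xs za show ?case
    by (intro exI[of _ "z # a # ys"]) auto
qed

section \<open>Girth and diameter from degrees and short walks\<close>

lemma walk_colour:
  fixes c :: "'a \<Rightarrow> bool"
  assumes "successively E xs" "xs \<noteq> []" "\<And>x y. E x y \<Longrightarrow> c x \<noteq> c y"
  shows "(c (hd xs) \<noteq> c (last xs)) \<longleftrightarrow> even (length xs)"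
  using assms(1,2)
proof (induction xs)
  case (Cons a xs)
  show ?case
  proof (cases "xs = []")
    case False
    with Cons have IH: "(c (hd xs) \<noteq> c (last xs)) \<longleftrightarrow> even (length xs)" and "c a \<noteq> c (hd xs)"
      using assms(3)[of a "hd xs"] by (auto simp: successively_Cons)
    then have "(c a \<noteq> c (last xs)) \<longleftrightarrow> odd (length xs)"
      by blast
    with False show ?thesis by simp
  qed simp
qed simp

text \<open>Minimal degree 2 and the girth bound supply long paths, which force both equalities. A
  path with n + 1 edges is closed by a walk of length at most n - 1 to a cycle of length at most 2
  n; a walk of length less than n between the ends of a path with n edges would give a cycle shorter
  than 2 n.\<close>

lemma polygon_criterion:
  fixes c :: "'a \<Rightarrow> bool"
  assumes "2 \<le> n" and "symp E" and col: "\<And>x y. E x y \<Longrightarrow> c x \<noteq> c y"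
    and deg: "\<And>x. \<exists>a b. a \<noteq> b \<and> E x a \<and> E x b"
    and cyc: "\<And>xs. xs \<in> cycles E \<Longrightarrow> 2 * n \<le> length xs"
    and short: "\<And>x y. (c x \<noteq> c y) = odd (n - 1) \<Longrightarrow> \<exists>m \<le> n - 1. (E ^^ m) x y"
  shows "graph_girth E = enat (2 * n)" "graph_diameter E = enat n"
proof -
  have irrefl: "\<not> E x x" for x
    using col by blast
  have path: "\<exists>xs. length xs = Suc k \<and> distinct xs \<and> successively E xs" if "k < 2 * n" for k
    using long_path_exists[of E "2 * n" k] irrefl \<open>symp E\<close> deg cyc that by blast
  have no_short: "length p \<le> length q \<or> 2 * n + 2 \<le> length p + length q"
    if "length p \<le> 2 * n" "distinct p" "successively E p" "p \<noteq> []" "distinct q" "successively E q" "q \<noteq> []"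
      "hd p = hd q" "last p = last q" for p q
    using two_paths_imp_cycle[of E p q] cyc that \<open>symp E\<close> by (metis add_le_mono1 le_refl le_trans)
  show "graph_girth E = enat (2 * n)"
    unfolding eq_enat_iff
  proof (intro conjI allI impI)
    obtain p where p: "length p = n + 2" "distinct p" "successively E p"
      using path[of "n + 1"] \<open>2 \<le> n\<close> by auto
    then have "p \<noteq> []" by auto
    \<comment> \<open>The path has n + 1 edges, and n + 1 has the parity of n - 1.\<close>
    have "(c (hd p) \<noteq> c (last p)) = odd (n - 1)"
      using walk_colour[OF p(3) \<open>p \<noteq> []\<close>, of c] col p(1) \<open>2 \<le> n\<close> by auto
    then obtain m where m: "m \<le> n - 1" "(E ^^ m) (hd p) (last p)"
      using short by blast
    from relpowp_imp_path[OF m(2)] obtain q where q: "q \<noteq> []" "hd q = hd p" "last q = last p"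
      "successively E q" "distinct q" "length q \<le> Suc m" by blast
    have "\<exists>xs \<in> cycles E. length xs + 2 \<le> length p + length q"
      using p q m \<open>p \<noteq> []\<close> \<open>symp E\<close> \<open>2 \<le> n\<close> by (intro two_paths_imp_cycle) auto
    then show "graph_girth E \<le> enat (2 * n)"
      unfolding graph_girth_def INF_enat_le_iff using p q m \<open>2 \<le> n\<close> by force
  next
    fix k assume "k < 2 * n"
    then show "\<not> graph_girth E \<le> enat k"
      unfolding graph_girth_def INF_enat_le_iff using cyc by fastforce
  qed
  show "graph_diameter E = enat n"
    unfolding eq_enat_iff graph_diameter_le_iff
  proof (intro conjI allI impI)
    fix x y
    have "\<exists>m \<le> n. (E ^^ m) x y"
    proof (cases "(c x \<noteq> c y) = odd (n - 1)")
      case True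
      then show ?thesis using short[of x y] by (meson diff_le_self le_trans)
    next
      case False
      \<comment> \<open>One step changes the colour, so \<open>a\<close> and \<open>y\<close> have
        the parity to which \<open>short\<close> applies.\<close>
      obtain a where a: "E x a" using deg by blast
      then have "(c a \<noteq> c y) = odd (n - 1)"
        using False col[OF a] by auto
      then obtain m where "m \<le> n - 1" "(E ^^ m) a y"
        using short by blast
      then have "Suc m \<le> n" "(E ^^ Suc m) x y"
        using a \<open>2 \<le> n\<close> by (auto intro: relpowp_Suc_I2 simp del: relpowp.simps)
      then show ?thesis by blast
    qed
    then obtain m where m: "m \<le> n" "(E ^^ m) x y" by blast
    from relpowp_imp_path[OF this(2)] this(1)
    show "\<exists>xs. xs \<noteq> [] \<and> hd xs = x \<and> last xs = y \<and> successively E xs \<and> length xs - 1 \<le> n"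
      by force
  next
    fix k assume k: "k < n"
    obtain p where p: "length p = n + 1" "distinct p" "successively E p"
      using path[of n] \<open>2 \<le> n\<close> by auto
    then have "p \<noteq> []" by auto
    show "\<not> (\<forall>x y. \<exists>xs. xs \<noteq> [] \<and> hd xs = x \<and> last xs = y \<and> successively E xs \<and> length xs - 1 \<le> k)"
    proof
      assume "\<forall>x y. \<exists>xs. xs \<noteq> [] \<and> hd xs = x \<and> last xs = y \<and> successively E xs \<and> length xs - 1 \<le> k"
      then obtain w where w: "w \<noteq> []" "hd w = hd p" "last w = last p" "successively E w" "length w - 1 \<le> k"
        by blast
      from relpowp_imp_path[OF walk_imp_relpowp[OF w(4,1)]] obtain q where
        "q \<noteq> []" "hd q = hd p" "last q = last p" "successively E q" "distinct q" "length q \<le> Suc (length w - 1)"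
        unfolding w(2,3) by blast
      with no_short[of p q] p k w(5) \<open>p \<noteq> []\<close> \<open>2 \<le> n\<close> show False
        by auto
    qed
  qed
qed

text \<open>Indexing by all integers frees later arguments from the place where the list is cut: the
  starting point changes by a shift, the direction by a sign.\<close>

lemma cycle_int_function:
  assumes "xs \<in> cycles R"
  obtains f :: "int \<Rightarrow> 'a" where "\<And>i. R (f i) (f (i + 1))" "range f = set xs"
    "\<And>i j. f i = f j \<longleftrightarrow> int (length xs) dvd i - j"
proof -
  define m where "m = int (length xs)"
  have xs: "3 \<le> m" "distinct xs" "successively R xs" "R (last xs) (hd xs)"
    using assms by (auto simp: cycles_def m_def)
  define f where "f i = xs ! nat (i mod m)" for i
  have lt: "nat (i mod m) < length xs" for i
  proof -
    have "0 \<le> i mod m" "i mod m < int (length xs)"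
      using xs(1) pos_mod_bound[of m i] pos_mod_sign[of m i] m_def by linarith+
    then show ?thesis by (simp only: nat_less_iff)
  qed
  show ?thesis
  proof (rule that[of f])
    fix i
    show "R (f i) (f (i + 1))"
    proof (cases "i mod m = m - 1")
      case True
      then have "(i + 1) mod m = 0"
        by (metis add.commute add_diff_cancel_left' diff_add_cancel mod_add_left_eq mod_self)
      moreover have "xs \<noteq> []"
        using xs(1) by (auto simp: m_def)
      ultimately have "f (i + 1) = hd xs" "f i = last xs"
        using True xs(1) by (auto simp: f_def m_def hd_conv_nth last_conv_nth nat_diff_distrib)
      with xs(4) show ?thesis by simp
    next
      case False
      then have "(i + 1) mod m = i mod m + 1"
        using xs(1) by (smt (verit) mod_add_left_eq mod_pos_pos_trivial pos_mod_bound pos_mod_sign)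
      then have "nat ((i + 1) mod m) = Suc (nat (i mod m))"
        using xs(1) by (simp add: nat_add_distrib)
      with lt[of "i + 1"] xs(3) show ?thesis
        by (simp add: f_def successively_conv_nth)
    qed
  next
    show "range f = set xs"
    proof
      show "range f \<subseteq> set xs"
        using lt by (auto simp: f_def)
      show "set xs \<subseteq> range f"
      proof
        fix x assume "x \<in> set xs"
        then obtain k where "k < length xs" "xs ! k = x" by (auto simp: in_set_conv_nth)
        then have "f (int k) = x"
          by (simp add: f_def m_def)
        then show "x \<in> range f" by blast
      qed
    qed
  next
    fix i j
    have "f i = f j \<longleftrightarrow> nat (i mod m) = nat (j mod m)"
      unfolding f_def using xs(2) lt by (simp add: nth_eq_iff_index_eq)
    also have "\<dots> \<longleftrightarrow> i mod m = j mod m"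
      using xs(1) by (auto simp: eq_nat_nat_iff)
    finally show "f i = f j \<longleftrightarrow> int (length xs) dvd i - j"
      by (simp add: m_def mod_eq_dvd_iff)
  qed
qed

lemma cycle_degree:
  assumes "xs \<in> cycles R" "\<And>x y. R x y \<Longrightarrow> R y x" "s \<in> set xs"
  shows "\<exists>a\<in>set xs. \<exists>b\<in>set xs. a \<noteq> b \<and> R s a \<and> R s b"
proof -
  obtain f where f: "\<And>i. R (f i) (f (i + 1))" "range f = set xs"
    "\<And>i j. f i = f j \<longleftrightarrow> int (length xs) dvd i - j"
    using cycle_int_function[OF assms(1)] by metis
  obtain i where i: "s = f i"
    using \<open>s \<in> set xs\<close> f(2) by auto
  have "3 \<le> length xs"
    using assms(1) by (simp add: cycles_def)
  then have "f (i + 1) \<noteq> f (i - 1)"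
    unfolding f(3) by (auto dest: zdvd_imp_le)
  moreover have "R s (f (i + 1))" "R s (f (i - 1))"
    using f(1)[of i] f(1)[of "i - 1"] i assms(2) by auto
  ultimately show ?thesis
    using f(2) by blast
qed

section \<open>Free completion of a partial polygon\<close>

text \<open>\<open>New x y i\<close> stands for the vertex at position \<open>i\<close> on a path
  added from \<open>x\<close> to \<open>y\<close>. As a term records its ends, the stages for all
  graphs live in one countable type, and adding a path means admitting terms.\<close>

datatype 'a element = Base 'a | New "'a element" "'a element" nat

instance element :: (countable) countable
  by countable_datatype

definition path_vertex :: "nat \<Rightarrow> 'a element \<Rightarrow> 'a element \<Rightarrow> nat \<Rightarrow> 'a element" where
  "path_vertex n x y i = (if i = 0 then x else if n - 1 \<le> i then y else New x y i)"

definition path_step :: "nat \<Rightarrow> 'a element \<Rightarrow> 'a element \<Rightarrow> bool" where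
  "path_step n s t \<longleftrightarrow> (\<exists>x y i. i < n - 1 \<and> s = path_vertex n x y i \<and> t = path_vertex n x y (Suc i))"

text \<open>Adjacency is defined on all terms, whether or not their paths are ever added. The stages
  only select vertices, so each stage is an induced subgraph of the next.\<close>

definition adjacent :: "nat \<Rightarrow> ('a \<Rightarrow> 'a \<Rightarrow> bool) \<Rightarrow> 'a element \<Rightarrow> 'a element \<Rightarrow> bool" where
  "adjacent n E s t \<longleftrightarrow>
     (\<exists>a b. s = Base a \<and> t = Base b \<and> E a b) \<or> path_step n s t \<or> path_step n t s"

primrec colour :: "('a \<Rightarrow> bool) \<Rightarrow> 'a element \<Rightarrow> bool" where
  "colour c (Base a) = c a"
| "colour c (New x y i) = (colour c x \<noteq> odd i)"

definition induced :: "('a \<Rightarrow> 'a \<Rightarrow> bool) \<Rightarrow> 'a set \<Rightarrow> 'a \<Rightarrow> 'a \<Rightarrow> bool" where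
  "induced E S x y \<longleftrightarrow> x \<in> S \<and> y \<in> S \<and> E x y"

text \<open>A path of length \<open>n - 1\<close> between \<open>x\<close> and \<open>y\<close> respects the colouring iff the colours of the
  ends differ exactly for odd \<open>n - 1\<close>.\<close>

definition joinable :: "nat \<Rightarrow> ('a \<Rightarrow> bool) \<Rightarrow> ('a \<Rightarrow> 'a \<Rightarrow> bool) \<Rightarrow> 'a element set \<Rightarrow>
    'a element \<Rightarrow> 'a element \<Rightarrow> bool" where
  "joinable n c E S x y \<longleftrightarrow> x \<in> S \<and> y \<in> S \<and> (colour c x \<noteq> colour c y) = odd (n - 1) \<and>
     \<not> (\<exists>m \<le> n - 1. (induced (adjacent n E) S ^^ m) x y)"

text \<open>Comparing codes orients each new path, so that an unordered pair of ends is joined only once.\<close>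

primrec stage :: "nat \<Rightarrow> ('a::countable \<Rightarrow> bool) \<Rightarrow> 'a set \<Rightarrow> ('a \<Rightarrow> 'a \<Rightarrow> bool) \<Rightarrow> nat \<Rightarrow> 'a element set"
where
  "stage n c W E 0 = Base ` W"
| "stage n c W E (Suc k) = stage n c W E k \<union>
     {New x y i | x y i. joinable n c E (stage n c W E k) x y \<and> to_nat x < to_nat y \<and> 0 < i \<and> i < n - 1}"

definition completion ::
  "nat \<Rightarrow> ('a::countable \<Rightarrow> bool) \<Rightarrow> 'a set \<Rightarrow> ('a \<Rightarrow> 'a \<Rightarrow> bool) \<Rightarrow> 'a element set" where
  "completion n c W E = (\<Union>k. stage n c W E k)"

text \<open>The function \<open>f\<close> enumerates a chain of \<open>n - 2\<close> vertices of degree at most 2 in \<open>S\<close>.\<close>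

definition confined :: "nat \<Rightarrow> ('a \<Rightarrow> 'a \<Rightarrow> bool) \<Rightarrow> 'a set \<Rightarrow> bool" where
  "confined n R S \<longleftrightarrow> finite S \<and> (\<forall>v\<in>S. \<exists>a\<in>S. \<exists>b\<in>S. a \<noteq> b \<and> R v a \<and> R v b) \<and>
     \<not> (\<exists>f. inj_on f {..<n - 2} \<and> f ` {..<n - 2} \<subseteq> S \<and> (\<forall>i. Suc i < n - 2 \<longrightarrow> R (f i) (f (Suc i))) \<and>
          (\<forall>i<n - 2. \<exists>a b. \<forall>w\<in>S. R (f i) w \<longrightarrow> w \<in> {a, b}))"

definition core :: "nat \<Rightarrow> ('a \<Rightarrow> 'a \<Rightarrow> bool) \<Rightarrow> 'a set" where
  "core n R = \<Union> {S. confined n R S}"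

section \<open>Invariance of the core under isomorphisms\<close>

lemma confined_image:
  assumes "confined n R S" "inj_on h S" "\<And>u v. u \<in> S \<Longrightarrow> v \<in> S \<Longrightarrow> R' (h u) (h v) = R u v"
  shows "confined n R' (h ` S)"
  unfolding confined_def
proof (intro conjI notI)
  show "finite (h ` S)"
    using assms(1) by (auto simp: confined_def)
  have *: "\<exists>a\<in>S. \<exists>b\<in>S. a \<noteq> b \<and> R v a \<and> R v b" if "v \<in> S" for v
    using assms(1) that by (auto simp: confined_def)
  show "\<forall>v\<in>h ` S. \<exists>a\<in>h ` S. \<exists>b\<in>h ` S. a \<noteq> b \<and> R' v a \<and> R' v b"
    using * assms(2,3) by (fastforce simp: inj_on_eq_iff)
next
  assume "\<exists>f. inj_on f {..<n - 2} \<and> f ` {..<n - 2} \<subseteq> h ` S \<and>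
    (\<forall>i. Suc i < n - 2 \<longrightarrow> R' (f i) (f (Suc i))) \<and>
    (\<forall>i<n - 2. \<exists>a b. \<forall>w\<in>h ` S. R' (f i) w \<longrightarrow> w \<in> {a, b})"
  then obtain f where f: "inj_on f {..<n - 2}" "f ` {..<n - 2} \<subseteq> h ` S"
    "\<And>i. Suc i < n - 2 \<Longrightarrow> R' (f i) (f (Suc i))"
    "\<And>i. i < n - 2 \<Longrightarrow> \<exists>a b. \<forall>w\<in>h ` S. R' (f i) w \<longrightarrow> w \<in> {a, b}"
    by blast
  \<comment> \<open>A forbidden chain in the image is pulled back to a forbidden chain in
    \<open>S\<close>.\<close>
  define g where "g i = the_inv_into S h (f i)" for i
  have g: "g i \<in> S" "h (g i) = f i" if "i < n - 2" for i
    using that f(2) assms(2) unfolding g_def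
    by (auto intro!: the_inv_into_into f_the_inv_into_f simp: image_subset_iff)
  have "inj_on g {..<n - 2}"
    using g f(1) by (metis inj_onD inj_onI lessThan_iff)
  moreover have "\<exists>a b. \<forall>w\<in>S. R (g i) w \<longrightarrow> w \<in> {a, b}" if i: "i < n - 2" for i
  proof -
    obtain a b where ab: "\<forall>w\<in>h ` S. R' (f i) w \<longrightarrow> w \<in> {a, b}"
      using f(4)[OF i] by blast
    have "w \<in> {the_inv_into S h a, the_inv_into S h b}" if "w \<in> S" "R (g i) w" for w
    proof -
      have "R' (f i) (h w)"
        using that assms(3)[of "g i" w] g[OF i] by simp
      with ab that(1) have "h w \<in> {a, b}" by blast
      with that(1) assms(2) show ?thesis
        by (auto simp: the_inv_into_f_f)
    qed
    then show ?thesis by blast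
  qed
  moreover have "R (g i) (g (Suc i))" if "Suc i < n - 2" for i
    using f(3)[OF that] g[of i] g[of "Suc i"] assms(3)[of "g i" "g (Suc i)"] that by auto
  ultimately show False
    using assms(1) g(1) unfolding confined_def by (metis image_subset_iff lessThan_iff)
qed

text \<open>Every vertex of a confined set has an edge, so confined sets lie in the carriers
  \<open>A\<close> and \<open>B\<close>, where \<open>h\<close> and its inverse transport
  them.\<close>

lemma core_image:
  assumes h: "bij_betw h A B"
    and R: "\<And>u v. R u v \<Longrightarrow> u \<in> A" and R': "\<And>u v. R' u v \<Longrightarrow> u \<in> B"
    and hom: "\<And>u v. u \<in> A \<Longrightarrow> v \<in> A \<Longrightarrow> R' (h u) (h v) = R u v"
  shows "h ` core n R = core n R'"
proof
  show "h ` core n R \<subseteq> core n R'"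
  proof
    fix t assume "t \<in> h ` core n R"
    then obtain S where S: "confined n R S" "t \<in> h ` S" by (auto simp: core_def)
    then have "S \<subseteq> A" using R by (auto simp: confined_def)
    then have "confined n R' (h ` S)"
      using S(1) h hom by (intro confined_image[OF S(1)]) (auto simp: bij_betw_def intro: inj_on_subset)
    with S(2) show "t \<in> core n R'" by (auto simp: core_def)
  qed
  show "core n R' \<subseteq> h ` core n R"
  proof
    fix t assume "t \<in> core n R'"
    then obtain S where S: "confined n R' S" "t \<in> S" by (auto simp: core_def)
    then have SB: "S \<subseteq> B" using R' by (auto simp: confined_def)
    define k where "k = the_inv_into A h"
    have k: "k t \<in> A" "h (k t) = t" if "t \<in> B" for t
      using that h unfolding k_def bij_betw_def
      by (auto intro: the_inv_into_into f_the_inv_into_f)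
    have "confined n R (k ` S)"
    proof (rule confined_image[OF S(1)])
      show "inj_on k S"
        using k(2) SB by (metis inj_onI subsetD)
      show "R (k u) (k v) = R' u v" if "u \<in> S" "v \<in> S" for u v
        using hom[of "k u" "k v"] k[of u] k[of v] subsetD[OF SB that(1)] subsetD[OF SB that(2)] by simp
    qed
    moreover have "t = h (k t)" using k(2) S(2) SB by auto
    ultimately show "t \<in> h ` core n R"
      using S(2) unfolding core_def by blast
  qed
qed

text \<open>The conditions on a base whose free completion is a generalised polygon: girth at least
  2 n and no loose ends. A bound on distances is absent because the added paths supply it. With n at
  least 3 each of them has an interior vertex.\<close>

locale partial_polygon =
  fixes n :: nat and c :: "'a::countable \<Rightarrow> bool" and W :: "'a set" and E :: "'a \<Rightarrow> 'a \<Rightarrow> bool"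
  assumes n3: "3 \<le> n"
    and sym: "E a b \<Longrightarrow> E b a"
    and in_W: "E a b \<Longrightarrow> a \<in> W"
    and colour_base: "E a b \<Longrightarrow> c a \<noteq> c b"
    and degree_base: "a \<in> W \<Longrightarrow> \<exists>b d. b \<noteq> d \<and> E a b \<and> E a d"
    and girth_base: "xs \<in> cycles E \<Longrightarrow> 2 * n \<le> length xs"
begin

section \<open>The stages of the free completion\<close>

abbreviation "stg \<equiv> stage n c W E"
abbreviation "F \<equiv> completion n c W E"
abbreviation "adj \<equiv> adjacent n E"
abbreviation "pv \<equiv> path_vertex n"
abbreviation "new_pair k x y \<equiv> joinable n c E (stg k) x y \<and> to_nat x < to_nat y"

lemma pv_0 [simp]: "pv x y 0 = x"
  and pv_last [simp]: "pv x y (n - Suc 0) = y"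
  and pv_mid [simp]: "0 < i \<Longrightarrow> i < n - Suc 0 \<Longrightarrow> pv x y i = New x y i"
  using n3 by (auto simp: path_vertex_def)

lemma adj_sym: "adj s t \<Longrightarrow> adj t s"
  unfolding adjacent_def using sym by blast

lemma adj_pv: "i < n - 1 \<Longrightarrow> adj (pv x y i) (pv x y (Suc i))"
  unfolding adjacent_def path_step_def by blast

lemma stage_mono: "k \<le> l \<Longrightarrow> stg k \<subseteq> stg l"
  by (rule lift_Suc_mono_le) (auto simp: stage.simps(2))

lemma Base_in_stage [simp]: "Base a \<in> stg k \<longleftrightarrow> a \<in> W"
  by (induction k) (auto simp: stage.simps(2))

declare stage.simps(2) [simp del]

lemma stage_subset: "stg k \<subseteq> F"
  by (auto simp: completion_def)

lemma New_stage_cases: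
  assumes "New x y i \<in> stg k"
  obtains j where "j < k" "new_pair j x y" "0 < i" "i < n - 1"
  using assms by (induction k) (auto simp: stage.simps(2) intro: less_SucI)

lemma New_in_stage:
  "new_pair j x y \<Longrightarrow> 0 < i \<Longrightarrow> i < n - 1 \<Longrightarrow> j < k \<Longrightarrow> New x y i \<in> stg k"
  using stage_mono[of "Suc j" k] by (auto simp: stage.simps(2))

lemma pv_in_stage:
  assumes "new_pair j x y" "i \<le> n - 1" "j < k"
  shows "pv x y i \<in> stg k"
proof -
  have "x \<in> stg k" "y \<in> stg k"
    using assms stage_mono[of j k] by (auto simp: joinable_def)
  then show ?thesis
    using New_in_stage[OF assms(1) _ _ assms(3)] by (auto simp: path_vertex_def)
qed

lemma New_stage_ends:
  assumes "New x y i \<in> stg (Suc k)"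
  shows "x \<in> stg k" "y \<in> stg k"
proof -
  obtain j where j: "j < Suc k" "new_pair j x y"
    using assms by (rule New_stage_cases)
  then show "x \<in> stg k" "y \<in> stg k"
    using stage_mono[of j k] by (auto simp: joinable_def)
qed

text \<open>The condition for adding a path does not mention the position, so its interior vertices
  all enter at the same stage.\<close>

lemma New_not_stage:
  assumes "New x y i \<in> stg (Suc k)" "New x y i \<notin> stg k"
  shows "new_pair k x y" "0 < i" "i < n - 1"
    "i' < n - 1 \<Longrightarrow> 0 < i' \<Longrightarrow> New x y i' \<in> stg (Suc k) - stg k"
proof -
  show *: "new_pair k x y" "0 < i" "i < n - 1"
    using assms by (auto simp: stage.simps(2))
  show "New x y i' \<in> stg (Suc k) - stg k" if "i' < n - 1" "0 < i'"
    using New_in_stage[OF *(1) that(2,1), of "Suc k"] New_stage_cases[of x y i' k]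
      New_in_stage[OF _ *(2,3)] assms(2) by blast
qed

lemma adj_colour:
  assumes "s \<in> stg k" "t \<in> stg k" "adj s t"
  shows "colour c s \<noteq> colour c t"
proof -
  have *: "colour c s \<noteq> colour c t" if st: "s \<in> stg k" "t \<in> stg k" "path_step n s t" for s t
  proof -
    obtain x y i where i: "i < n - 1" "s = pv x y i" "t = pv x y (Suc i)"
      using st(3) by (auto simp: path_step_def)
    \<comment> \<open>Of two consecutive vertices on a path of length n - 1 \<ge> 2 at least one is
      interior. Its presence shows that the path was added, so the ends have the prescribed
      parity.\<close>
    have "\<exists>i. New x y i \<in> stg k"
      using i st n3 by (intro exI[of _ "if i = 0 then 1 else i"]) auto
    then obtain j where "new_pair j x y"
      by (meson New_stage_cases)
    then have "(colour c x \<noteq> colour c y) = odd (n - 1)"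
      by (auto simp: joinable_def)
    then have "colour c (pv x y l) = (colour c x \<noteq> odd l)" if "l \<le> n - 1" for l
      using that by (auto simp: path_vertex_def)
    then show ?thesis
      unfolding i using i(1) by (metis Suc_leI even_Suc less_imp_le_nat)
  qed
  from assms(3) show ?thesis
    unfolding adjacent_def using *[of s t] *[of t s] assms colour_base by auto
qed

text \<open>All paths present at stage \<open>Suc k\<close> have their ends in stage
  \<open>k\<close>. A vertex that is new at stage \<open>Suc k\<close> is thus not an end of any of
  them, which leaves only its neighbours on its own path.\<close>

lemma New_neighbours:
  assumes new: "New x y i \<in> stg (Suc k)" "New x y i \<notin> stg k" and t: "t \<in> stg (Suc k)" "adj (New x y i) t"
  shows "t \<in> {pv x y (i - 1), pv x y (Suc i)}"
proof -
  note i = New_not_stage(2,3)[OF new]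
  have not_end: "New x y i \<noteq> z \<and> New x y i \<noteq> z'" if "New z z' l \<in> stg (Suc k)" for z z' l
    using New_stage_ends[OF that] new by blast
  from t(2) consider "path_step n (New x y i) t" | "path_step n t (New x y i)"
    by (auto simp: adjacent_def)
  then show ?thesis
  proof cases
    case 1
    then obtain x' y' i' where *: "i' < n - 1" "New x y i = pv x' y' i'" "t = pv x' y' (Suc i')"
      by (auto simp: path_step_def)
    show ?thesis
    proof (cases "i' = 0")
      case True
      with * n3 have "t = New x' y' 1" "New x y i = x'" by auto
      with not_end t show ?thesis by blast
    qed (use * in auto)
  next
    case 2
    then obtain x' y' i' where *: "i' < n - 1" "t = pv x' y' i'" "New x y i = pv x' y' (Suc i')"
      by (auto simp: path_step_def)
    show ?thesis
    proof (cases "Suc i' = n - 1")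
      case True
      then have "t = New x' y' i'" "New x y i = y'"
        using * n3 pv_last[of x' y'] by (auto simp: path_vertex_def)
      with not_end t show ?thesis by blast
    qed (use * in auto)
  qed
qed

lemma joinable_sym:
  assumes "joinable n c E S x y"
  shows "joinable n c E S y x"
proof -
  have "(induced adj S ^^ m) x y" if "(induced adj S ^^ m) y x" for m
    using that by (rule relpowp_sym) (auto simp: induced_def adj_sym)
  with assms show ?thesis
    unfolding joinable_def by auto
qed

section \<open>Degrees and distances in the completion\<close>

lemma completion_degree:
  assumes "s \<in> F"
  shows "\<exists>a b. a \<noteq> b \<and> a \<in> F \<and> b \<in> F \<and> adj s a \<and> adj s b"
proof (cases s)
  case (Base a)
  with assms have "a \<in> W" by (auto simp: completion_def)
  then obtain b d where bd: "b \<noteq> d" "E a b" "E a d"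
    using degree_base by blast
  then have "b \<in> W" "d \<in> W"
    using in_W sym by blast+
  with bd show ?thesis
    by (intro exI[of _ "Base b"] exI[of _ "Base d"]) (auto simp: completion_def adjacent_def Base)
next
  case (New x y i)
  with assms obtain k where "New x y i \<in> stg k" by (auto simp: completion_def)
  then obtain j where j: "new_pair j x y" "0 < i" "i < n - 1"
    by (rule New_stage_cases)
  have "pv x y (i - 1) \<in> F" "pv x y (Suc i) \<in> F"
    using pv_in_stage[OF j(1), of _ "Suc j"] stage_subset[of "Suc j"] j(2,3) by auto
  moreover have "adj s (pv x y (i - 1))" "adj s (pv x y (Suc i))"
    using adj_pv[of "i - 1" x y] adj_pv[of i x y] j(2,3) adj_sym by (auto simp: New)
  \<comment> \<open>Only for n = 3 are both neighbours ends of the path; they differ because their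
    codes do.\<close>
  moreover have "x \<noteq> y"
    using j(1) by auto
  then have "pv x y (i - 1) \<noteq> pv x y (Suc i)"
    using j(2,3) by (auto simp: path_vertex_def)
  ultimately show ?thesis by blast
qed

text \<open>Both vertices lie in a common stage. There they are already close enough, or the next
  stage joins them by a path of length n - 1.\<close>

lemma completion_short:
  assumes "x \<in> F" "y \<in> F" "(colour c x \<noteq> colour c y) = odd (n - 1)"
  shows "\<exists>m \<le> n - 1. (induced adj F ^^ m) x y"
proof -
  have *: "\<exists>m \<le> n - 1. (induced adj F ^^ m) x y"
    if xy: "x \<in> F" "y \<in> F" "(colour c x \<noteq> colour c y) = odd (n - 1)" "to_nat x < to_nat y" for x y
  proof -
    obtain k l where "x \<in> stg k" "y \<in> stg l"
      using xy by (auto simp: completion_def)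
    then have k: "x \<in> stg (max k l)" "y \<in> stg (max k l)"
      using stage_mono by (meson max.cobounded1 max.cobounded2 subsetD)+
    show ?thesis
    proof (cases "joinable n c E (stg (max k l)) x y")
      case True
      then have "pv x y i \<in> F" if "i \<le> n - 1" for i
        using pv_in_stage[of "max k l" x y i "Suc (max k l)"] stage_subset xy(4) that by blast
      then have "(induced adj F ^^ (n - 1)) (pv x y 0) (pv x y (n - 1))"
        by (intro path_relpowp) (simp add: induced_def adj_pv)
      then show ?thesis by auto
    next
      case False
      then obtain m where "m \<le> n - 1" "(induced adj (stg (max k l)) ^^ m) x y"
        using k xy by (auto simp: joinable_def)
      then show ?thesis
        using relpowp_map[of m "induced adj (stg (max k l))" x y "induced adj F" "\<lambda>s. s"]
          stage_subset[of "max k l"] by (auto simp: induced_def)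
    qed
  qed
  consider "to_nat x < to_nat y" | "to_nat y < to_nat x" | "x = y"
    by (metis linorder_neqE_nat to_nat_split)
  then show ?thesis
  proof cases
    case 2
    then obtain m where "m \<le> n - 1" "(induced adj F ^^ m) y x"
      using *[of y x] assms by auto
    moreover from this(2) have "(induced adj F ^^ m) x y"
      by (rule relpowp_sym) (auto simp: induced_def adj_sym)
    ultimately show ?thesis by blast
  next
    case 3
    then show ?thesis by (intro exI[of _ 0]) auto
  qed (use * assms in auto)
qed

text \<open>A new path has length at least 2, so two base vertices are never consecutive on
  it.\<close>

lemma adj_Base [simp]: "adj (Base a) (Base b) \<longleftrightarrow> E a b"
proof -
  have "\<not> path_step n (Base a) (Base b)" for a b :: 'a
  proof
    assume "path_step n (Base a) (Base b)"
    then obtain x y i where "i < n - 1" "Base a = pv x y i" "Base b = pv x y (Suc i)"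
      by (auto simp: path_step_def)
    then show False
      using n3 by (cases "i = 0") (auto simp: path_vertex_def split: if_splits)
  qed
  then show ?thesis by (auto simp: adjacent_def)
qed

text \<open>A new vertex has two candidates for neighbours and needs two neighbours in
  \<open>S\<close>, so both candidates belong to \<open>S\<close>. From position \<open>i\<close>
  this spreads to both ends. Cycles and confined sets are the two applications.\<close>

lemma closed_contains_path:
  assumes S: "S \<subseteq> stg (Suc k)" "\<And>s. s \<in> S \<Longrightarrow> \<exists>a\<in>S. \<exists>b\<in>S. a \<noteq> b \<and> adj s a \<and> adj s b"
    and new: "New x y i \<in> S" "New x y i \<notin> stg k" and "l \<le> n - 1"
  shows "pv x y l \<in> S"
proof -
  have "New x y i \<in> stg (Suc k)"
    using S(1) new by blast
  note i = New_not_stage[OF this new(2)]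
  have nbrs: "pv x y (l - 1) \<in> S \<and> pv x y (Suc l) \<in> S" if l: "0 < l" "l < n - 1" "pv x y l \<in> S" for l
  proof -
    have "New x y l \<in> stg (Suc k)" "New x y l \<notin> stg k"
      using i(4) l by auto
    note nb = New_neighbours[OF this]
    obtain a b where "a \<in> S" "b \<in> S" "a \<noteq> b" "adj (New x y l) a" "adj (New x y l) b"
      using S(2)[of "New x y l"] l by auto
    with nb S(1) show ?thesis by blast
  qed
  show ?thesis
  proof (cases "i \<le> l")
    case True
    then show ?thesis using \<open>l \<le> n - 1\<close>
    proof (induction l rule: dec_induct)
      case base
      then show ?case using new i by simp
    next
      case (step l)
      then show ?case using i by (intro nbrs[THEN conjunct2]) auto
    qed
  next
    case False
    then have "l \<le> i" by simp
    then show ?thesis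
    proof (induction l rule: inc_induct)
      case base
      then show ?case using new i by simp
    next
      case (step l)
      have "pv x y (Suc l - 1) \<in> S"
        using step i \<open>i < n - 1\<close> by (intro nbrs[THEN conjunct1]) auto
      then show ?case by simp
    qed
  qed
qed

section \<open>Finite subgraphs and the girth of the completion\<close>

lemma finite_subset_stage:
  assumes "finite S" "S \<subseteq> F"
  shows "\<exists>k. S \<subseteq> stg k"
  using assms
proof (induction S)
  case (insert x S)
  then obtain k l where "S \<subseteq> stg k" "x \<in> stg l"
    by (auto simp: completion_def)
  then have "insert x S \<subseteq> stg (max k l)"
    using stage_mono[of k "max k l"] stage_mono[of l "max k l"] by auto
  then show ?case by blast
qed simp

lemma last_stage:
  assumes "finite S" "S \<subseteq> F" "\<not> S \<subseteq> Base ` W"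
  obtains k x y i where "S \<subseteq> stg (Suc k)" "New x y i \<in> S" "New x y i \<notin> stg k"
proof -
  define k where "k = (LEAST k. S \<subseteq> stg k)"
  have k: "S \<subseteq> stg k"
    unfolding k_def using finite_subset_stage[OF assms(1,2)] by (rule LeastI_ex)
  have "k \<noteq> 0"
    using k assms(3) by (intro notI) simp
  then obtain j where j: "k = Suc j" by (cases k) auto
  then have "\<not> S \<subseteq> stg j"
    using not_less_Least[of j "\<lambda>k. S \<subseteq> stg k"] unfolding k_def by simp
  then obtain s where s: "s \<in> S" "s \<notin> stg j" by blast
  then obtain x y i where "s = New x y i"
    using k j by (auto simp: stage.simps(2))
  with s k j that show thesis by blast
qed

text \<open>The two interiors have n - 2 vertices each, and there are at least three ends: the pairs
  differ, and the order of the codes prevents one from being the reverse of the other. This makes 2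
  n - 1.\<close>

lemma two_paths_card:
  assumes "new_pair k x y" "new_pair k x' y'" "(x, y) \<noteq> (x', y')"
    "New x y i \<notin> stg k" "New x' y' i' \<notin> stg k"
    "New x y i \<in> stg (Suc k)" "New x' y' i' \<in> stg (Suc k)"
    and "finite S" and S: "\<And>l. l \<le> n - 1 \<Longrightarrow> pv x y l \<in> S" "\<And>l. l \<le> n - 1 \<Longrightarrow> pv x' y' l \<in> S"
  shows "2 * n \<le> Suc (card S)"
proof -
  let ?A = "New x y ` {1..<n - 1}" and ?B = "New x' y' ` {1..<n - 1}" and ?C = "{x, y, x', y'}"
  have stg: "?C \<subseteq> stg k"
    using assms(1,2) by (auto simp: joinable_def)
  have new: "(?A \<union> ?B) \<inter> stg k = {}"
    using New_not_stage(4)[OF assms(6,4)] New_not_stage(4)[OF assms(7,5)] by auto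
  have "card ?A = n - 2" "card ?B = n - 2"
    by (auto simp: card_image inj_on_def)
  moreover have "?A \<inter> ?B = {}"
    using assms(3) by auto
  moreover have "(?A \<union> ?B) \<inter> ?C = {}"
    using stg new by blast
  ultimately have "card (?A \<union> ?B \<union> ?C) = (n - 2) + (n - 2) + card ?C"
    by (subst card_Un_disjoint) (auto simp: card_Un_disjoint)
  moreover have "3 \<le> card ?C"
  proof -
    have "x \<noteq> y" "x' \<noteq> y'" "x' \<noteq> y \<or> y' \<noteq> x"
      using assms(1,2) by auto
    then show ?thesis
      using assms(3) by (auto simp: card_insert_if)
  qed
  moreover have "New x y l \<in> S" "New x' y' l \<in> S" if "0 < l" "l < n - 1" for l
    using S[of l] that by simp_all
  then have "?A \<union> ?B \<union> ?C \<subseteq> S"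
    using S[of 0] S[of "n - 1"] by auto
  then have "card (?A \<union> ?B \<union> ?C) \<le> card S"
    using \<open>finite S\<close> by (rule card_mono[rotated])
  ultimately show ?thesis
    using n3 by linarith
qed

text \<open>Consider the last stage met by a short cycle. Two new paths of that stage would give 2 n
  - 1 vertices, hence 2 n by evenness. So there is just one, and the rest of the cycle is a walk
  between its ends inside the previous stage. An even m < 2 n leaves it m - (n - 1) \<le> n - 1
  edges, against the condition under which the ends were joined.\<close>

lemma completion_girth:
  assumes "xs \<in> cycles (induced adj F)"
  shows "2 * n \<le> length xs"
proof (rule ccontr)
  assume short: "\<not> 2 * n \<le> length xs"
  have xs: "3 \<le> length xs" "distinct xs" "successively (induced adj F) xs"
      "induced adj F (last xs) (hd xs)"
    using assms by (auto simp: cycles_def)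
  define m where "m = length xs"
  obtain f where f: "\<And>i. induced adj F (f i) (f (i + 1))" "range f = set xs"
    "\<And>i j. f i = f j \<longleftrightarrow> int m dvd i - j"
    using cycle_int_function[OF assms] unfolding m_def by metis
  have "set xs \<subseteq> F"
    unfolding f(2)[symmetric] using f(1) by (auto simp: induced_def)
  have "even m"
  proof -
    have ne: "xs \<noteq> []" using xs(1) by auto
    have col: "colour c s \<noteq> colour c t" if "induced adj F s t" for s t
      using that adj_colour[of s _ t] finite_subset_stage[of "{s, t}"] by (auto simp: induced_def)
    show ?thesis
      using walk_colour[OF xs(3) ne, of "colour c"] col xs(4) unfolding m_def by blast
  qed
  have two: "f (i + 1) \<noteq> f (i - 1)" for i
    unfolding f(3) using xs(1) by (auto simp: m_def dest: zdvd_imp_le)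
  have deg: "\<exists>a\<in>set xs. \<exists>b\<in>set xs. a \<noteq> b \<and> adj s a \<and> adj s b" if "s \<in> set xs" for s
    using cycle_degree[OF assms _ that] adj_sym unfolding induced_def by blast
  show False
  proof (cases "set xs \<subseteq> Base ` W")
    case True
    then obtain ys where ys: "xs = map Base ys"
      by (metis (no_types, lifting) ex_map_conv image_iff subset_eq)
    have "ys \<in> cycles E"
    proof -
      have "successively (\<lambda>a b. induced adj F (Base a) (Base b)) ys"
        using xs(3) by (simp add: ys successively_map)
      then have "successively E ys"
        by (rule successively_mono) (auto simp: induced_def)
      then show ?thesis
        using xs by (cases "ys = []") (auto simp: cycles_def ys distinct_map last_map hd_map induced_def)
    qed
    from girth_base[OF this] short show False
      by (simp add: ys)
  next
    case False
    then obtain k x y i where k: "set xs \<subseteq> stg (Suc k)" and new: "New x y i \<in> set xs" "New x y i \<notin> stg k"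
      using last_stage[of "set xs"] \<open>set xs \<subseteq> F\<close> by (metis List.finite_set)
    have "New x y i \<in> stg (Suc k)" using k new by blast
    note i = New_not_stage[OF this new(2)]
    have path: "pv x y l \<in> set xs" if "l \<le> n - 1" for l
      using closed_contains_path[OF k deg new that] by blast
    \<comment> \<open>All vertices that are new at this stage belong to one path.\<close>
    have unique: "\<exists>l. s = New x y l \<and> 0 < l \<and> l < n - 1" if s: "s \<in> set xs" "s \<notin> stg k" for s
    proof -
      obtain x' y' i' where s': "s = New x' y' i'"
        using s k by (auto simp: stage.simps(2))
      have new': "New x' y' i' \<in> set xs" "New x' y' i' \<notin> stg k"
        using s s' by auto
      have "New x' y' i' \<in> stg (Suc k)" using k new' by blast
      note i' = New_not_stage[OF this new'(2)]
      have path': "pv x' y' l \<in> set xs" if "l \<le> n - 1" for l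
        using closed_contains_path[OF k deg new' that] by blast
      have "(x, y) = (x', y')"
      proof (rule ccontr)
        assume "(x, y) \<noteq> (x', y')"
        then have "2 * n \<le> Suc (card (set xs))"
          using i(1) i'(1) new(2) new'(2) \<open>New x y i \<in> stg (Suc k)\<close> \<open>New x' y' i' \<in> stg (Suc k)\<close> path path'
          by (intro two_paths_card[of k x y x' y' i i']) auto
        then have "2 * n \<le> Suc m"
          using xs(2) by (simp add: distinct_card m_def)
        with short \<open>even m\<close> show False
          unfolding m_def by presburger
      qed
      with s' i' show ?thesis by auto
    qed
    have "New x y 1 \<in> range f"
      using path[of 1] n3 f(2) by simp
    then obtain k0 where k0: "f k0 = New x y 1"
      by (metis imageE)
    have nb: "t \<in> {pv x y (l - 1), pv x y (Suc l)}"
      if "adj (New x y l) t" "t \<in> set xs" "0 < l" "l < n - 1" for t l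
      using New_neighbours[of x y l k t] i(4)[of l] that k by blast
    \<comment> \<open>The cycle is rotated, and reversed if necessary, so that it enters the new
      path from \<open>x\<close> and has its first interior vertex at index 0.\<close>
    have "\<exists>g. (\<forall>i. adj (g i) (g (i + 1))) \<and> (\<forall>i. g i \<in> set xs) \<and>
      (\<forall>i j. g i = g j \<longleftrightarrow> int m dvd i - j) \<and> g 0 = New x y 1 \<and> g (- 1) = x"
    proof -
      have adjf: "adj (f i) (f (i + 1))" "adj (f (i + 1)) (f i)" for i
        using f(1)[of i] adj_sym by (auto simp: induced_def)
      have ft: "f i \<in> set xs" for i using f(2) by blast
      have "f (k0 + 1) \<in> {x, pv x y 2}" "f (k0 - 1) \<in> {x, pv x y 2}"
        using nb[of 1 "f (k0 + 1)"] nb[of 1 "f (k0 - 1)"] adjf(1)[of k0] adjf(2)[of "k0 - 1"] k0 ft n3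
        by (auto simp: numeral_2_eq_2)
      with two[of k0] consider "f (k0 - 1) = x" | "f (k0 + 1) = x" by fastforce
      then show ?thesis
      proof cases
        case 1
        show ?thesis
          by (rule exI[of _ "\<lambda>i. f (k0 + i)"]) (use 1 k0 adjf ft in \<open>auto simp: f(3) add.assoc[symmetric]\<close>)
      next
        case 2
        have "adj (f (k0 - i)) (f (k0 - (i + 1)))" for i
          using adjf(2)[of "k0 - (i + 1)"] by simp
        then show ?thesis
          by (intro exI[of _ "\<lambda>i. f (k0 - i)"]) (use 2 k0 ft in \<open>auto simp: f(3) dvd_diff_commute\<close>)
      qed
    qed
    then obtain g where g: "\<And>i. adj (g i) (g (i + 1))" "\<And>i. g i \<in> set xs"
      "\<And>i j. g i = g j \<longleftrightarrow> int m dvd i - j" "g 0 = New x y 1" "g (- 1) = x"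
      by blast
    have m3: "3 \<le> m" using xs(1) by (simp add: m_def)
    \<comment> \<open>A cycle does not turn back, and an interior vertex has only two neighbours
      here, so the cycle follows the path as far as \<open>y\<close>.\<close>
    have along: "g (int l) = pv x y (Suc l) \<and> g (int l - 1) = pv x y l" if "l \<le> n - 2" for l
      using that
    proof (induction l)
      case 0
      then show ?case using g(4,5) n3 by simp
    next
      case (Suc l)
      then have l: "g (int l) = New x y (Suc l)" "g (int l - 1) = pv x y l"
        using n3 by auto
      have "g (int l + 1) \<in> {pv x y l, pv x y (Suc (Suc l))}"
        using nb[of "Suc l" "g (int l + 1)"] g(1)[of "int l"] g(2) l(1) Suc.prems n3 by auto
      moreover have "g (int l + 1) \<noteq> g (int l - 1)"
        unfolding g(3) using m3 by (auto dest: zdvd_imp_le)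
      ultimately have "g (int l + 1) = pv x y (Suc (Suc l))"
        using l by auto
      then show ?case
        using l(1) Suc.prems n3 by (simp add: add.commute)
    qed
    \<comment> \<open>A shorter cycle would return to \<open>New x y 1\<close> while still on the
      path or at its end \<open>y\<close>.\<close>
    have mn: "n - 2 < m"
    proof (rule ccontr)
      assume "\<not> n - 2 < m"
      then have "g (int m) = pv x y (Suc m)" using along[of m] by simp
      moreover have "g (int m) = g 0" unfolding g(3) by simp
      moreover have "y \<in> stg k"
        using i(1) by (auto simp: joinable_def)
      then have "y \<noteq> New x y 1"
        using i(4)[of 1] n3 by auto
      ultimately show False using g(4) m3 by (auto simp: path_vertex_def split: if_splits)
    qed
    \<comment> \<open>The interior vertices occupy the indices 0 to n - 3, and indices below
      \<open>m\<close> do not repeat a vertex.\<close>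
    have old: "g (int t) \<in> stg k" if t: "n - 2 \<le> t" "t < m" for t
    proof (rule ccontr)
      assume "g (int t) \<notin> stg k"
      then obtain l where l: "g (int t) = New x y l" "0 < l" "l < n - 1"
        using unique[of "g (int t)"] g(2) by blast
      then have "g (int (l - 1)) = g (int t)"
        using along[of "l - 1"] by auto
      then have "int m dvd int t - int (l - 1)"
        unfolding g(3) by (simp add: dvd_diff_commute)
      moreover have "0 < int t - int (l - 1)" "int t - int (l - 1) < int m"
        using l t by auto
      ultimately show False
        using zdvd_not_zless by blast
    qed
    \<comment> \<open>The remaining arc, from \<open>y\<close> at index n - 2 to \<open>x\<close> at
      index m - 1.\<close>
    define h where "h t = g (int (n - 2 + t))" for t
    have "(induced adj (stg k) ^^ (m - (n - 1))) (h 0) (h (m - (n - 1)))"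
    proof (rule path_relpowp)
      fix t assume t: "t < m - (n - 1)"
      then have "n - 2 + Suc t < m"
        using n3 by linarith
      then show "induced adj (stg k) (h t) (h (Suc t))"
        using old[of "n - 2 + t"] old[of "n - 2 + Suc t"] g(1)[of "int (n - 2 + t)"]
        unfolding h_def induced_def by (simp add: algebra_simps)
    qed
    moreover have "h 0 = y"
      using along[of "n - 2"] n3 unfolding h_def by (simp add: path_vertex_def)
    moreover have "h (m - (n - 1)) = x"
    proof -
      have "n - 2 + (m - (n - 1)) = m - 1"
        using mn n3 by simp
      then have "h (m - (n - 1)) = g (int m - 1)"
        using m3 by (simp add: h_def of_nat_diff)
      also have "\<dots> = g (- 1)" unfolding g(3) by simp
      finally show ?thesis using g(5) by simp
    qed
    ultimately have "(induced adj (stg k) ^^ (m - (n - 1))) y x" by simp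
    then have "(induced adj (stg k) ^^ (m - (n - 1))) x y"
      by (rule relpowp_sym) (auto simp: induced_def adj_sym)
    moreover have "m - (n - 1) \<le> n - 1"
      using short \<open>even m\<close> by (auto simp: m_def elim!: evenE)
    ultimately show False
      using i(1) unfolding joinable_def by blast
  qed
qed

section \<open>Recovering the base from the completion\<close>

lemma confined_in_base:
  assumes "confined n (induced adj F) S"
  shows "S \<subseteq> Base ` W"
proof (rule ccontr)
  have deg: "\<exists>a\<in>S. \<exists>b\<in>S. a \<noteq> b \<and> induced adj F s a \<and> induced adj F s b" if "s \<in> S" for s
    using assms that by (auto simp: confined_def)
  then have deg': "\<exists>a\<in>S. \<exists>b\<in>S. a \<noteq> b \<and> adj s a \<and> adj s b" if "s \<in> S" for s
    using that unfolding induced_def by blast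
  have "S \<subseteq> F"
    using deg by (auto simp: induced_def)
  moreover have "finite S"
    using assms by (auto simp: confined_def)
  moreover assume "\<not> S \<subseteq> Base ` W"
  ultimately obtain k x y i where k: "S \<subseteq> stg (Suc k)" and new: "New x y i \<in> S" "New x y i \<notin> stg k"
    using last_stage by metis
  have "New x y i \<in> stg (Suc k)" using k new by blast
  note i = New_not_stage[OF this new(2)]
  have path: "pv x y l \<in> S" if "l \<le> n - 1" for l
    using closed_contains_path[OF k deg' new that] by blast
  \<comment> \<open>The shift by one skips the end \<open>x\<close>: positions 1 to n - 2 are the
    interior of the path, which is the forbidden chain.\<close>
  define f where "f l = New x y (Suc l)" for l
  have f: "f l = pv x y (Suc l)" if "l < n - 2" for l
    using that by (simp add: f_def)
  have "inj_on f {..<n - 2}"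
    by (auto simp: inj_on_def f_def)
  moreover have "f l \<in> S" if "l < n - 2" for l
    using path[of "Suc l"] f[of l] that by simp
  then have "f ` {..<n - 2} \<subseteq> S"
    by blast
  moreover have "induced adj F (f l) (f (Suc l))" if "Suc l < n - 2" for l
    using that adj_pv[of "Suc l" x y] path[of "Suc l"] path[of "Suc (Suc l)"] \<open>S \<subseteq> F\<close> f[of l] f[of "Suc l"]
    by (auto simp: induced_def simp del: pv_mid)
  moreover have "\<exists>a b. \<forall>w\<in>S. induced adj F (f l) w \<longrightarrow> w \<in> {a, b}" if "l < n - 2" for l
  proof (intro exI ballI impI)
    fix w assume "w \<in> S" "induced adj F (f l) w"
    then show "w \<in> {pv x y (Suc l - 1), pv x y (Suc (Suc l))}"
      using New_neighbours[of x y "Suc l" k w] i(4)[of "Suc l"] that k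
      by (auto simp: f_def induced_def simp del: pv_mid)
  qed
  ultimately show False
    using assms unfolding confined_def by blast
qed

text \<open>Confinement depends only on the induced graph. Confined sets of the completion lie in
  the base, where the induced graph is \<open>E\<close>, so the confined sets of the two graphs
  correspond.\<close>

lemma core_completion: "core n (induced adj F) = Base ` core n E"
proof
  show "core n (induced adj F) \<subseteq> Base ` core n E"
  proof
    fix s assume "s \<in> core n (induced adj F)"
    then obtain S where S: "confined n (induced adj F) S" "s \<in> S"
      by (auto simp: core_def)
    from confined_in_base[OF S(1)] obtain T where T: "T \<subseteq> W" "S = Base ` T"
      by (meson subset_imageE)
    have "confined n E ((\<lambda>s. case s of Base a \<Rightarrow> a) ` S)"
      using S(1) by (rule confined_image) (use T in \<open>auto simp: inj_on_def induced_def completion_def\<close>)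
    moreover have "(\<lambda>s. case s of Base a \<Rightarrow> a) ` S = T"
      unfolding T by (auto simp: image_image)
    ultimately show "s \<in> Base ` core n E"
      using S(2) T by (auto simp: core_def)
  qed
next
  show "Base ` core n E \<subseteq> core n (induced adj F)"
  proof
    fix s assume "s \<in> Base ` core n E"
    then obtain T where T: "confined n E T" "s \<in> Base ` T"
      by (auto simp: core_def)
    then have "T \<subseteq> W"
      using in_W by (auto simp: confined_def)
    then have "confined n (induced adj F) (Base ` T)"
      using T by (intro confined_image[OF T(1)]) (auto simp: inj_on_def induced_def completion_def)
    with T show "s \<in> core n (induced adj F)"
      by (auto simp: core_def)
  qed
qed

section \<open>The completion as a geometry on the natural numbers\<close>

lemma completion_colour:
  assumes "s \<in> F" "t \<in> F" "adj s t"
  shows "colour c s \<noteq> colour c t"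
  using assms adj_colour[of s _ t] finite_subset_stage[of "{s, t}"] by auto

lemma completion_polygon:
  fixes e :: "nat \<Rightarrow> 'a element"
  assumes e: "bij_betw e UNIV F"
  shows "(\<lambda>i. colour c (e i), \<lambda>i. \<not> colour c (e i), \<lambda>i j. adj (e i) (e j)) \<in> generalised_polygons n"
proof -
  define I where "I i j = adj (e i) (e j)" for i j
  have eF: "e i \<in> F" for i using e by (auto simp: bij_betw_def)
  have inj: "inj e" using e by (simp add: bij_betw_def)
  have ex: "\<exists>i. s = e i" if "s \<in> F" for s using e that by (auto simp: bij_betw_def)
  have "2 \<le> n" using n3 by simp
  moreover have sym: "symp I"
    using adj_sym by (auto simp: symp_def I_def)
  moreover have col: "colour c (e i) \<noteq> colour c (e j)" if "I i j" for i j
    using completion_colour[OF eF eF] that by (simp add: I_def)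
  moreover have "\<exists>a b. a \<noteq> b \<and> I i a \<and> I i b" for i
    using completion_degree[OF eF[of i]] ex unfolding I_def by metis
  moreover have "2 * n \<le> length xs" if xs: "xs \<in> cycles I" for xs
  proof -
    have "successively (\<lambda>i j. induced adj F (e i) (e j)) xs"
      using xs eF by (auto simp: cycles_def induced_def I_def)
    moreover have "xs \<noteq> []" using xs by (auto simp: cycles_def)
    ultimately have "map e xs \<in> cycles (induced adj F)"
      using xs inj eF by (auto simp: cycles_def successively_map distinct_map last_map hd_map induced_def I_def
        intro: inj_on_subset)
    then show ?thesis using completion_girth by fastforce
  qed
  moreover have "\<exists>m \<le> n - 1. (I ^^ m) i j" if c: "(colour c (e i) \<noteq> colour c (e j)) = odd (n - 1)" for i j
  proof -
    obtain m where m: "m \<le> n - 1" "(induced adj F ^^ m) (e i) (e j)"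
      using completion_short[OF eF eF c] by blast
    have "(I ^^ m) (inv e (e i)) (inv e (e j))"
    proof (rule relpowp_map[OF m(2)])
      fix s t assume st: "induced adj F s t"
      then obtain i j where "s = e i" "t = e j" using ex unfolding induced_def by metis
      with st inj show "I (inv e s) (inv e t)" by (simp add: induced_def I_def)
    qed
    with m(1) inj show ?thesis by auto
  qed
  ultimately have "graph_girth I = enat (2 * n)" "graph_diameter I = enat n"
    using polygon_criterion[of n I "\<lambda>i. colour c (e i)"] by blast+
  then show ?thesis
    using sym col unfolding generalised_polygons_def I_def by auto
qed

end

section \<open>Isomorphisms of free completions\<close>

text \<open>A map of the base need not preserve the order of the codes, so the orientation of a new path may
  have to be reversed.\<close>

primrec lift_base :: "nat \<Rightarrow> ('a \<Rightarrow> 'b) \<Rightarrow> 'a element \<Rightarrow> 'b::countable element" where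
  "lift_base n h (Base a) = Base (h a)"
| "lift_base n h (New x y i) =
     (if to_nat (lift_base n h x) < to_nat (lift_base n h y)
      then New (lift_base n h x) (lift_base n h y) i
      else New (lift_base n h y) (lift_base n h x) (n - 1 - i))"

lemma lift_base_path_vertex:
  assumes "i \<le> n - 1" "3 \<le> n"
  shows "lift_base n h (path_vertex n x y i) =
    (if to_nat (lift_base n h x) < to_nat (lift_base n h y)
     then path_vertex n (lift_base n h x) (lift_base n h y) i
     else path_vertex n (lift_base n h y) (lift_base n h x) (n - 1 - i))"
  using assms by (auto simp: path_vertex_def)

lemma lift_base_path_step:
  assumes "path_step n s t" "3 \<le> n"
  shows "path_step n (lift_base n h s) (lift_base n h t) \<or> path_step n (lift_base n h t) (lift_base n h s)"
proof -
  obtain x y i where i: "i < n - 1" "s = path_vertex n x y i" "t = path_vertex n x y (Suc i)"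
    using assms(1) by (auto simp: path_step_def)
  define x' y' where "x' = lift_base n h x" and "y' = lift_base n h y"
  show ?thesis
  proof (cases "to_nat x' < to_nat y'")
    case True
    then have "lift_base n h s = path_vertex n x' y' i" "lift_base n h t = path_vertex n x' y' (Suc i)"
      using i assms(2) by (auto simp: lift_base_path_vertex x'_def y'_def)
    with i show ?thesis unfolding path_step_def by blast
  next
    case False
    then have "lift_base n h s = path_vertex n y' x' (Suc (n - 1 - Suc i))"
      "lift_base n h t = path_vertex n y' x' (n - 1 - Suc i)"
      using i assms(2) by (auto simp: lift_base_path_vertex x'_def y'_def Suc_diff_Suc)
    moreover have "n - 1 - Suc i < n - 1" using i by auto
    ultimately show ?thesis unfolding path_step_def by blast
  qed
qed

lemma lift_base_adjacent:
  assumes "adjacent n E s t" "3 \<le> n" "\<And>a b. E a b \<Longrightarrow> E' (h a) (h b)"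
  shows "adjacent n E' (lift_base n h s) (lift_base n h t)"
  using assms lift_base_path_step[of n s t h] lift_base_path_step[of n t s h]
  unfolding adjacent_def by auto

text \<open>That the images of a joined pair are again far apart is shown by pulling a short walk
  back along \<open>g\<close>. Hence the step for \<open>f\<close> needs that \<open>g\<close> maps
  stage \<open>k\<close> back to stage \<open>k\<close>.\<close>

lemma lift_base_stage_step:
  fixes c :: "'a::countable \<Rightarrow> bool" and c' :: "'b::countable \<Rightarrow> bool"
  assumes "partial_polygon n c W E" "partial_polygon n c' W' E'"
    and fwd: "\<And>s. s \<in> stage n c W E k \<Longrightarrow> lift_base n f s \<in> stage n c' W' E' k \<and>
      lift_base n g (lift_base n f s) = s \<and> colour c' (lift_base n f s) = colour c s"
    and bwd: "\<And>s. s \<in> stage n c' W' E' k \<Longrightarrow> lift_base n g s \<in> stage n c W E k"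
    and hom: "\<And>a b. E' a b \<Longrightarrow> E (g a) (g b)"
    and s: "s \<in> stage n c W E (Suc k)"
  shows "lift_base n f s \<in> stage n c' W' E' (Suc k) \<and>
      lift_base n g (lift_base n f s) = s \<and> colour c' (lift_base n f s) = colour c s"
proof (cases "s \<in> stage n c W E k")
  case True
  then show ?thesis using fwd by (simp add: stage.simps(2))
next
  case False
  interpret A: partial_polygon n c W E by fact
  interpret B: partial_polygon n c' W' E' by fact
  obtain x y i where xy: "s = New x y i" "A.new_pair k x y" "0 < i" "i < n - 1"
    using s False by (auto simp: stage.simps(2))
  then have "x \<in> A.stg k" "y \<in> A.stg k" and odd: "(colour c x \<noteq> colour c y) = odd (n - 1)"
    by (auto simp: joinable_def)
  note x = fwd[OF this(1)] and y = fwd[OF this(2)]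
  let ?x = "lift_base n f x" and ?y = "lift_base n f y"
  have adj: "A.adj (lift_base n g u) (lift_base n g v)" if "B.adj u v" for u v
    using that A.n3 hom by (rule lift_base_adjacent)
  have "joinable n c' E' (B.stg k) ?x ?y"
    unfolding joinable_def
  proof (intro conjI notI)
    assume "\<exists>m\<le>n - 1. (induced B.adj (B.stg k) ^^ m) ?x ?y"
    then obtain m where m: "m \<le> n - 1" "(induced B.adj (B.stg k) ^^ m) ?x ?y" by blast
    from m(2) have "(induced A.adj (A.stg k) ^^ m) (lift_base n g ?x) (lift_base n g ?y)"
      by (rule relpowp_map) (use bwd adj in \<open>auto simp: induced_def\<close>)
    with x y m(1) xy(2) show False
      by (auto simp: joinable_def)
  qed (use x y odd in auto)
  note join = this B.joinable_sym[OF this]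
  show ?thesis
  proof (cases "to_nat ?x < to_nat ?y")
    case True
    then show ?thesis
      using join x y xy by (auto simp: stage.simps(2))
  next
    case False
    \<comment> \<open>The \<open>else\<close> case of \<open>lift_base\<close> includes equal codes.
      Injectivity, seen through \<open>g\<close>, leaves only the strict reversed order.\<close>
    have "lift_base n g ?x \<noteq> lift_base n g ?y"
      using conjunct1[OF conjunct2[OF x]] conjunct1[OF conjunct2[OF y]] xy(2) by (metis less_irrefl)
    then have "?x \<noteq> ?y" by metis
    then have lt: "to_nat ?y < to_nat ?x"
      using False by (metis linorder_neqE_nat to_nat_split)
    have "lift_base n f s \<in> stage n c' W' E' (Suc k)"
      using False lt join xy B.New_in_stage[of k ?y ?x "n - 1 - i" "Suc k"] by simp
    moreover have "lift_base n g (lift_base n f s) = s"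
      using False x y xy by auto
    moreover have "colour c' (lift_base n f s) = colour c s"
    proof -
      \<comment> \<open>The colour is now counted from the other end, over n - 1 - i steps; the
        parity of a joinable pair makes both counts agree.\<close>
      have "odd (n - 1 - i) \<longleftrightarrow> odd (n - 1) \<noteq> odd i"
        using xy(4) by (auto simp: even_diff_nat)
      with odd y have "(colour c' ?y \<noteq> odd (n - 1 - i)) \<longleftrightarrow> (colour c x \<noteq> odd i)"
        by blast
      with False xy(1) show ?thesis by simp
    qed
    ultimately show ?thesis by blast
  qed
qed

text \<open>Free completion is functorial for isomorphisms of the base. One induction treats both
  maps, as each relies on the other one stage below.\<close>

lemma lift_base_completion:
  fixes c :: "'a::countable \<Rightarrow> bool" and c' :: "'b::countable \<Rightarrow> bool"
  assumes A: "partial_polygon n c W E" and B: "partial_polygon n c' W' E'"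
    and f: "\<And>a. a \<in> W \<Longrightarrow> f a \<in> W' \<and> g (f a) = a \<and> c' (f a) = c a" "\<And>a b. E a b \<Longrightarrow> E' (f a) (f b)"
    and g: "\<And>a. a \<in> W' \<Longrightarrow> g a \<in> W \<and> f (g a) = a \<and> c (g a) = c' a" "\<And>a b. E' a b \<Longrightarrow> E (g a) (g b)"
  shows "bij_betw (lift_base n f) (completion n c W E) (completion n c' W' E')"
    and "s \<in> completion n c W E \<Longrightarrow> colour c' (lift_base n f s) = colour c s"
    and "s \<in> completion n c W E \<Longrightarrow> t \<in> completion n c W E \<Longrightarrow>
      adjacent n E' (lift_base n f s) (lift_base n f t) \<longleftrightarrow> adjacent n E s t"
proof -
  interpret A: partial_polygon n c W E by fact
  interpret B: partial_polygon n c' W' E' by fact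
  have both: "(\<forall>s \<in> A.stg k. lift_base n f s \<in> B.stg k \<and>
      lift_base n g (lift_base n f s) = s \<and> colour c' (lift_base n f s) = colour c s) \<and>
    (\<forall>s \<in> B.stg k. lift_base n g s \<in> A.stg k \<and>
      lift_base n f (lift_base n g s) = s \<and> colour c (lift_base n g s) = colour c' s)" for k
  proof (induction k)
    case 0
    then show ?case using f g by auto
  next
    case (Suc k)
    have "lift_base n f s \<in> B.stg (Suc k) \<and>
      lift_base n g (lift_base n f s) = s \<and> colour c' (lift_base n f s) = colour c s"
      if "s \<in> A.stg (Suc k)" for s
      using lift_base_stage_step[where f = f and g = g and k = k, OF A B bspec[OF conjunct1[OF Suc]] conjunct1[OF bspec[OF conjunct2[OF Suc]]] g(2) that] .
    moreover have "lift_base n g s \<in> A.stg (Suc k) \<and>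
      lift_base n f (lift_base n g s) = s \<and> colour c (lift_base n g s) = colour c' s"
      if "s \<in> B.stg (Suc k)" for s
      using lift_base_stage_step[where f = g and g = f and k = k, OF B A bspec[OF conjunct2[OF Suc]] conjunct1[OF bspec[OF conjunct1[OF Suc]]] f(2) that] .
    ultimately show ?case by blast
  qed
  have fF: "lift_base n f s \<in> B.F" "lift_base n g (lift_base n f s) = s" "colour c' (lift_base n f s) = colour c s"
    if "s \<in> A.F" for s
    using that both by (auto simp: completion_def)
  have gF: "lift_base n g s \<in> A.F" "lift_base n f (lift_base n g s) = s" if "s \<in> B.F" for s
    using that both by (auto simp: completion_def)
  show "bij_betw (lift_base n f) A.F B.F"
    by (rule bij_betw_byWitness[where f' = "lift_base n g"]) (use fF gF in auto)
  show "colour c' (lift_base n f s) = colour c s" if "s \<in> A.F"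
    using fF that by blast
  show "adjacent n E' (lift_base n f s) (lift_base n f t) \<longleftrightarrow> adjacent n E s t" if "s \<in> A.F" "t \<in> A.F"
    using lift_base_adjacent[of n E s t E' f] lift_base_adjacent[of n E' "lift_base n f s" "lift_base n f t" E g]
      A.n3 f(2) g(2) fF(2)[OF that(1)] fF(2)[OF that(2)] by auto
qed

section \<open>Subdivision of linear spaces\<close>

lemma card_ge_3_imp_two:
  assumes "3 \<le> card A"
  shows "\<exists>x y. x \<noteq> y \<and> x \<in> A \<and> y \<in> A"
proof -
  obtain B where "B \<subseteq> A" "card B = 3"
    using assms obtain_subset_with_card_n by metis
  then show ?thesis by (auto simp: card_3_iff)
qed

datatype ('p, 'l) subdiv = Point 'p | Line 'l | Mid 'p 'l nat

instance subdiv :: (countable, countable) countable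
  by countable_datatype

text \<open>For n = 3 the path is a single edge without \<open>Mid\<close> vertices, and the
  construction returns the incidence graph itself.\<close>

definition edge_vertex :: "nat \<Rightarrow> 'p \<Rightarrow> 'l \<Rightarrow> nat \<Rightarrow> ('p, 'l) subdiv" where
  "edge_vertex n p l i = (if i = 0 then Point p else if n - 2 \<le> i then Line l else Mid p l i)"

definition edge_step :: "nat \<Rightarrow> ('p \<Rightarrow> 'l \<Rightarrow> bool) \<Rightarrow> ('p, 'l) subdiv \<Rightarrow> ('p, 'l) subdiv \<Rightarrow> bool" where
  "edge_step n J s t \<longleftrightarrow> (\<exists>p l i. J p l \<and> i < n - 2 \<and> s = edge_vertex n p l i \<and> t = edge_vertex n p l (Suc i))"

definition subdiv_adjacent :: "nat \<Rightarrow> ('p \<Rightarrow> 'l \<Rightarrow> bool) \<Rightarrow> ('p, 'l) subdiv \<Rightarrow> ('p, 'l) subdiv \<Rightarrow> bool"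
where
  "subdiv_adjacent n J s t \<longleftrightarrow> edge_step n J s t \<or> edge_step n J t s"

fun subdiv_vertex :: "nat \<Rightarrow> ('p \<Rightarrow> 'l \<Rightarrow> bool) \<Rightarrow> ('p, 'l) subdiv \<Rightarrow> bool" where
  "subdiv_vertex n J (Mid p l i) \<longleftrightarrow> J p l \<and> 0 < i \<and> i < n - 2"
| "subdiv_vertex n J _ \<longleftrightarrow> True"

text \<open>Edges become paths of length \<open>n - 2\<close>, so for even \<open>n\<close> points and lines have the same colour.\<close>

fun subdiv_colour :: "nat \<Rightarrow> ('p, 'l) subdiv \<Rightarrow> bool" where
  "subdiv_colour n (Point p) = False"
| "subdiv_colour n (Line l) = odd n"
| "subdiv_colour n (Mid p l i) = odd i"

definition incident :: "('p \<Rightarrow> 'l \<Rightarrow> bool) \<Rightarrow> 'p + 'l \<Rightarrow> 'p + 'l \<Rightarrow> bool" where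
  "incident J s t \<longleftrightarrow> (\<exists>p l. J p l \<and> (s = Inl p \<and> t = Inr l \<or> s = Inr l \<and> t = Inl p))"

text \<open>\<open>unique\<close> is the axiom of partial linear spaces and bars 4-cycles from the
  incidence graph. In \<open>covered\<close> only incidences between \<open>P\<close> and
  \<open>L\<close> are counted, so their points may lie on infinitely many lines outside
  \<open>L\<close>, as the hubs will.\<close>

locale linear_space =
  fixes n :: nat and J :: "'p::countable \<Rightarrow> 'l::countable \<Rightarrow> bool"
  assumes n3: "3 \<le> n"
    and unique: "J p l \<Longrightarrow> J p l' \<Longrightarrow> J q l \<Longrightarrow> J q l' \<Longrightarrow> p = q \<or> l = l'"
    and point_on_line: "\<exists>l. J p l" and line_has_point: "\<exists>p. J p l"
    and covered: "J p l \<Longrightarrow> \<exists>P L. finite P \<and> finite L \<and> p \<in> P \<and> l \<in> L \<and>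
      (\<forall>q\<in>P. 3 \<le> card {k\<in>L. J q k}) \<and> (\<forall>k\<in>L. 3 \<le> card {q\<in>P. J q k})"
begin

section \<open>The subdivided incidence graph\<close>

abbreviation "ev \<equiv> edge_vertex n"
abbreviation "E \<equiv> subdiv_adjacent n J"
abbreviation "W \<equiv> Collect (subdiv_vertex n J)"

lemma ev_0 [simp]: "ev p l 0 = Point p"
  and ev_last [simp]: "ev p l (n - 2) = Line l"
  and ev_mid [simp]: "0 < i \<Longrightarrow> i < n - 2 \<Longrightarrow> ev p l i = Mid p l i"
  using n3 by (auto simp: edge_vertex_def)

lemma E_sym: "E s t \<Longrightarrow> E t s"
  by (auto simp: subdiv_adjacent_def)

lemma E_ev: "J p l \<Longrightarrow> i < n - 2 \<Longrightarrow> E (ev p l i) (ev p l (Suc i))"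
  unfolding subdiv_adjacent_def edge_step_def by blast

lemma E_ev': "J p l \<Longrightarrow> i < n - 2 \<Longrightarrow> E (ev p l (Suc i)) (ev p l i)"
  using E_ev E_sym by blast

lemma E_cases:
  assumes "E s t"
  obtains p l i where "J p l" "i < n - 2" "s = ev p l i" "t = ev p l (Suc i)"
    | p l i where "J p l" "i < n - 2" "t = ev p l i" "s = ev p l (Suc i)"
  using assms unfolding subdiv_adjacent_def edge_step_def by blast

lemma ev_in_W: "J p l \<Longrightarrow> ev p l i \<in> W"
  by (auto simp: edge_vertex_def)

lemma ev_eq_Point: "i \<le> n - 2 \<Longrightarrow> ev p l i = Point q \<longleftrightarrow> i = 0 \<and> p = q"
  and ev_eq_Line: "i \<le> n - 2 \<Longrightarrow> ev p l i = Line k \<longleftrightarrow> i = n - 2 \<and> l = k"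
  and ev_eq_Mid: "i \<le> n - 2 \<Longrightarrow> ev p l i = Mid q k j \<longleftrightarrow> p = q \<and> l = k \<and> i = j \<and> 0 < i \<and> i < n - 2"
  using n3 by (auto simp: edge_vertex_def)

lemma eq_ev_Point: "i \<le> n - 2 \<Longrightarrow> Point q = ev p l i \<longleftrightarrow> i = 0 \<and> p = q"
  and eq_ev_Line: "i \<le> n - 2 \<Longrightarrow> Line k = ev p l i \<longleftrightarrow> i = n - 2 \<and> l = k"
  and eq_ev_Mid: "i \<le> n - 2 \<Longrightarrow> Mid q k j = ev p l i \<longleftrightarrow> p = q \<and> l = k \<and> i = j \<and> 0 < i \<and> i < n - 2"
  using n3 by (auto simp: edge_vertex_def)

lemmas ev_eq = ev_eq_Point ev_eq_Line ev_eq_Mid eq_ev_Point eq_ev_Line eq_ev_Mid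

lemma Point_neighbours: "E (Point p) t \<longleftrightarrow> (\<exists>l. J p l \<and> t = ev p l 1)"
proof
  assume "E (Point p) t"
  then show "\<exists>l. J p l \<and> t = ev p l 1"
    by (cases rule: E_cases) (auto simp: ev_eq)
next
  assume "\<exists>l. J p l \<and> t = ev p l 1"
  then show "E (Point p) t"
    using E_ev[of p _ 0] n3 by auto
qed

lemma Line_neighbours: "E (Line l) t \<longleftrightarrow> (\<exists>p. J p l \<and> t = ev p l (n - 3))"
proof
  assume "E (Line l) t"
  then show "\<exists>p. J p l \<and> t = ev p l (n - 3)"
  proof (cases rule: E_cases)
    case (2 p k i)
    then have "Suc i = n - 2" "k = l"
      using ev_eq_Line[of "Suc i" p k l] by auto
    then have "i = n - 3" by simp
    with 2 \<open>k = l\<close> show ?thesis by auto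
  qed (auto simp: ev_eq)
next
  assume "\<exists>p. J p l \<and> t = ev p l (n - 3)"
  moreover have "Suc (n - 3) = n - 2" using n3 by simp
  ultimately show "E (Line l) t"
    using E_ev'[of _ l "n - 3"] n3 by auto
qed

lemma Mid_neighbours:
  assumes "E (Mid p l i) t"
  shows "t = ev p l (i - 1) \<or> t = ev p l (Suc i)"
  using assms
proof (cases rule: E_cases)
  case (1 q k j)
  then show ?thesis using ev_eq_Mid[of j q k p l i] by auto
next
  case (2 q k j)
  then show ?thesis using ev_eq_Mid[of "Suc j" q k p l i] by auto
qed

lemma ev_inj: "0 < i \<Longrightarrow> i \<le> n - 2 \<Longrightarrow> ev p l i = ev p l' i \<longleftrightarrow> l = l'"
  and ev_inj': "i < n - 2 \<Longrightarrow> ev p l i = ev p' l i \<longleftrightarrow> p = p'"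
  by (auto simp: edge_vertex_def)

lemma two_lines: "\<exists>l l'. l \<noteq> l' \<and> J p l \<and> J p l'"
  and two_points: "\<exists>p p'. p \<noteq> p' \<and> J p l \<and> J p' l"
proof -
  obtain k where "J p k" using point_on_line by blast
  then obtain L where "3 \<le> card {k\<in>L. J p k}" using covered by blast
  then show "\<exists>l l'. l \<noteq> l' \<and> J p l \<and> J p l'" using card_ge_3_imp_two by blast
  obtain q where "J q l" using line_has_point by blast
  then obtain P where "3 \<le> card {q\<in>P. J q l}" using covered by blast
  then show "\<exists>p p'. p \<noteq> p' \<and> J p l \<and> J p' l" using card_ge_3_imp_two by blast
qed

lemma W_degree:
  assumes "s \<in> W"
  shows "\<exists>a b. a \<noteq> b \<and> E s a \<and> E s b"
proof (cases s)
  case (Point p)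
  obtain l l' where l: "l \<noteq> l'" "J p l" "J p l'" using two_lines by blast
  then have "ev p l 1 \<noteq> ev p l' 1" using n3 ev_inj[of 1 p l l'] by auto
  with l show ?thesis unfolding Point Point_neighbours by blast
next
  case (Line l)
  obtain p p' where p: "p \<noteq> p'" "J p l" "J p' l" using two_points by blast
  then have "ev p l (n - 3) \<noteq> ev p' l (n - 3)" using n3 ev_inj'[of "n - 3" p l p'] by auto
  with p show ?thesis unfolding Line Line_neighbours by blast
next
  case (Mid p l i)
  then have i: "J p l" "0 < i" "i < n - 2" using assms by auto
  then have "E s (ev p l (i - 1))" "E s (ev p l (Suc i))"
    using E_ev'[of p l "i - 1"] E_ev[of p l i] Mid by auto
  moreover have "ev p l (i - 1) \<noteq> ev p l (Suc i)"
    using i by (auto simp: edge_vertex_def)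
  ultimately show ?thesis by blast
qed

text \<open>The bound comes from three points, three lines, and the interiors of two subdivided flags.\<close>

lemma closed_card:
  assumes "finite S" "S \<noteq> {}" and S: "\<And>s. s \<in> S \<Longrightarrow> \<exists>a\<in>S. \<exists>b\<in>S. a \<noteq> b \<and> E s a \<and> E s b"
  shows "2 * n \<le> card S"
proof -
  \<comment> \<open>The flags whose whole subdivided path lies in \<open>S\<close>. One edge in
    \<open>S\<close> suffices for this, since interior vertices have only two neighbours.\<close>
  define A where "A p l \<longleftrightarrow> J p l \<and> (\<forall>k \<le> n - 2. ev p l k \<in> S)" for p l
  have nbrs: "ev p l (k - 1) \<in> S \<and> ev p l (Suc k) \<in> S" if k: "0 < k" "k < n - 2" "ev p l k \<in> S" for p l k
    using S[OF k(3)] Mid_neighbours[of p l k] k by (metis ev_mid)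
  have AI: "A p l" if i: "J p l" "i < n - 2" "ev p l i \<in> S" "ev p l (Suc i) \<in> S" for p l i
    unfolding A_def
  proof (intro conjI allI impI)
    fix k assume k: "k \<le> n - 2"
    show "ev p l k \<in> S"
    proof (cases "Suc i \<le> k")
      case True
      then show ?thesis using k
      proof (induction k rule: dec_induct)
        case (step k)
        then show ?case using nbrs[of k p l] by auto
      qed (use i in auto)
    next
      case False
      then have "k \<le> i" by simp
      then show ?thesis
      proof (induction k rule: inc_induct)
        case (step k)
        then show ?case using nbrs[of "Suc k" p l] i by auto
      qed (use i in auto)
    qed
  qed (use i in auto)
  have point: "\<exists>l l'. l \<noteq> l' \<and> A p l \<and> A p l'" if p: "Point p \<in> S" for p
  proof -
    obtain a b where ab: "a \<in> S" "b \<in> S" "a \<noteq> b" "E (Point p) a" "E (Point p) b"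
      using S[OF p] by blast
    then obtain l l' where l: "J p l" "J p l'" "a = ev p l 1" "b = ev p l' 1"
      by (auto simp: Point_neighbours)
    then have "A p l" "A p l'"
      using AI[of p l 0] AI[of p l' 0] ab p n3 by auto
    moreover have "l \<noteq> l'" using l ab by auto
    ultimately show ?thesis by blast
  qed
  have line: "\<exists>p p'. p \<noteq> p' \<and> A p l \<and> A p' l" if l: "Line l \<in> S" for l
  proof -
    obtain a b where ab: "a \<in> S" "b \<in> S" "a \<noteq> b" "E (Line l) a" "E (Line l) b"
      using S[OF l] by blast
    then obtain p p' where p: "J p l" "J p' l" "a = ev p l (n - 3)" "b = ev p' l (n - 3)"
      by (auto simp: Line_neighbours)
    have "Suc (n - 3) = n - 2" "n - 3 < n - 2" using n3 by auto
    then have "A p l" "A p' l"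
      using AI[of p l "n - 3"] AI[of p' l "n - 3"] ab p l by auto
    moreover have "p \<noteq> p'" using p ab by auto
    ultimately show ?thesis by blast
  qed
  have A_ends: "J p l \<and> Point p \<in> S \<and> Line l \<in> S" if "A p l" for p l
    using that n3 unfolding A_def by (metis ev_0 ev_last le0 order_refl)
  have "\<exists>p. Point p \<in> S"
  proof -
    obtain s where s: "s \<in> S" using assms(2) by blast
    then obtain t where t: "t \<in> S" "E s t" using S by blast
    from t(2) have "\<exists>p l. A p l"
      by (cases rule: E_cases) (use s t AI in blast)+
    then show ?thesis using A_ends by blast
  qed
  \<comment> \<open>The three points and three lines form the chain \<open>p2\<close>,
    \<open>l2\<close>, \<open>p\<close>, \<open>l1\<close>, \<open>p1\<close>, \<open>l3\<close>;
    the interiors counted are those of the two flags at \<open>p\<close>.\<close>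
  then obtain p l1 l2 where p: "Point p \<in> S" "l1 \<noteq> l2" "A p l1" "A p l2"
    using point by blast
  obtain p1 where p1: "p1 \<noteq> p" "A p1 l1"
    using line[of l1] A_ends[OF p(3)] by metis
  obtain p2 where p2: "p2 \<noteq> p" "A p2 l2"
    using line[of l2] A_ends[OF p(4)] by metis
  obtain l3 where l3: "l3 \<noteq> l1" "A p1 l3"
    using point[of p1] A_ends[OF p1(2)] by metis
  \<comment> \<open>If \<open>p1 = p2\<close> or \<open>l3 = l2\<close>, then \<open>p\<close> and
    \<open>p1\<close> would both lie on \<open>l1\<close> and on \<open>l2\<close>, which
    \<open>unique\<close> forbids.\<close>
  have "p1 \<noteq> p2"
    using p p1 p2 unique[of p l1 l2 p1] A_ends by blast
  moreover have "l3 \<noteq> l2"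
    using p p1 l3 unique[of p l1 l2 p1] A_ends by blast
  ultimately have "card (Point ` {p, p1, p2} :: ('p, 'l) subdiv set) = 3"
    "card (Line ` {l1, l2, l3} :: ('p, 'l) subdiv set) = 3"
    using p1 p2 p l3 by (auto simp: card_insert_if)
  moreover have "card (Mid p l1 ` {1..<n - 2}) = n - 3" "card (Mid p l2 ` {1..<n - 2}) = n - 3"
    by (auto simp: card_image inj_on_def)
  then have "card (Mid p l1 ` {1..<n - 2} \<union> Mid p l2 ` {1..<n - 2}) = (n - 3) + (n - 3)"
    using p(2) by (subst card_Un_disjoint) auto
  ultimately have "card (Point ` {p, p1, p2} \<union> Line ` {l1, l2, l3} \<union>
      (Mid p l1 ` {1..<n - 2} \<union> Mid p l2 ` {1..<n - 2})) = 3 + 3 + ((n - 3) + (n - 3))"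
    by (subst card_Un_disjoint; (subst card_Un_disjoint)?) (auto simp: card_Un_disjoint)
  moreover have "Mid p l1 k \<in> S" "Mid p l2 k \<in> S" if "1 \<le> k" "k < n - 2" for k
    using p(3,4) that unfolding A_def by (metis ev_mid less_imp_le_nat less_le_trans zero_less_one)+
  then have "Point ` {p, p1, p2} \<union> Line ` {l1, l2, l3} \<union>
      (Mid p l1 ` {1..<n - 2} \<union> Mid p l2 ` {1..<n - 2}) \<subseteq> S"
    using p p1 p2 l3 A_ends by auto
  ultimately have "3 + 3 + ((n - 3) + (n - 3)) \<le> card S"
    using card_mono[OF \<open>finite S\<close>] by metis
  then show ?thesis using n3 by simp
qed

lemma partial_polygon: "partial_polygon n (subdiv_colour n) W E"
proof
  show "E a b \<Longrightarrow> a \<in> W" for a b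
    using ev_in_W by (auto elim!: E_cases)
  show "subdiv_colour n a \<noteq> subdiv_colour n b" if "E a b" for a b
  proof -
    have col: "subdiv_colour n (ev p l i) = odd i" if "i \<le> n - 2" for p l i
      using that n3 by (auto simp: edge_vertex_def)
    from that show ?thesis
      by (cases rule: E_cases) (auto simp: col)
  qed
  show "2 * n \<le> length xs" if "xs \<in> cycles E" for xs
  proof -
    have "2 * n \<le> card (set xs)"
      using that cycle_degree[OF that E_sym] by (intro closed_card) (auto simp: cycles_def)
    also have "\<dots> \<le> length xs" by (rule card_length)
    finally show ?thesis .
  qed
qed (use n3 E_sym W_degree in auto)

text \<open>Points and lines of \<open>S\<close> have three neighbours in \<open>S\<close>, so a
  forbidden chain consists of \<open>Mid\<close> vertices. It cannot leave its flag, where only n -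
  3 of the required n - 2 vertices are available.\<close>

lemma confined_flags:
  assumes "finite P" "finite L" and P: "\<And>q. q \<in> P \<Longrightarrow> 3 \<le> card {k\<in>L. J q k}"
    and L: "\<And>k. k \<in> L \<Longrightarrow> 3 \<le> card {q\<in>P. J q k}"
  defines "S \<equiv> {ev p l i | p l i. p \<in> P \<and> l \<in> L \<and> J p l \<and> i \<le> n - 2}"
  shows "confined n E S"
proof -
  have evS: "p \<in> P \<Longrightarrow> l \<in> L \<Longrightarrow> J p l \<Longrightarrow> i \<le> n - 2 \<Longrightarrow> ev p l i \<in> S" for p l i
    unfolding S_def by blast
  have point: "p \<in> P" if "Point p \<in> S" for p
    using that unfolding S_def by (auto simp: ev_eq)
  have line: "l \<in> L" if "Line l \<in> S" for l
    using that unfolding S_def by (auto simp: ev_eq)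
  have mid: "p \<in> P \<and> l \<in> L \<and> J p l \<and> 0 < i \<and> i < n - 2" if "Mid p l i \<in> S" for p l i
    using that unfolding S_def by (auto simp: ev_eq)
  have not2: "\<not> card A \<le> 2 \<Longrightarrow> finite A \<Longrightarrow> \<not> A \<subseteq> {a, b}" for A :: "('p, 'l) subdiv set" and a b
    using card_mono[of "{a, b}" A] card_insert_le_m1[of 2 "{b}" a] by (auto simp: card_insert_if split: if_splits)
  have deg: "\<exists>w\<in>S. E (Point p) w \<and> w \<notin> {a, b}" if "Point p \<in> S" for p a b
  proof -
    have "inj_on (\<lambda>l. ev p l 1) {k\<in>L. J p k}"
      using n3 by (auto simp: inj_on_def ev_inj)
    then have "card ((\<lambda>l. ev p l 1) ` {k\<in>L. J p k}) = card {k\<in>L. J p k}"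
      by (rule card_image)
    then have "\<not> (\<lambda>l. ev p l 1) ` {k\<in>L. J p k} \<subseteq> {a, b}"
      using P[OF point[OF that]] \<open>finite L\<close> by (intro not2) auto
    then obtain l where "l \<in> L" "J p l" "ev p l 1 \<notin> {a, b}" by blast
    then show ?thesis
      using evS[of p l 1] point[OF that] n3 by (intro bexI[of _ "ev p l 1"]) (auto simp: Point_neighbours)
  qed
  have deg': "\<exists>w\<in>S. E (Line l) w \<and> w \<notin> {a, b}" if "Line l \<in> S" for l a b
  proof -
    have "inj_on (\<lambda>p. ev p l (n - 3)) {q\<in>P. J q l}"
      using n3 by (auto simp: inj_on_def ev_inj')
    then have "card ((\<lambda>p. ev p l (n - 3)) ` {q\<in>P. J q l}) = card {q\<in>P. J q l}"
      by (rule card_image)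
    then have "\<not> (\<lambda>p. ev p l (n - 3)) ` {q\<in>P. J q l} \<subseteq> {a, b}"
      using L[OF line[OF that]] \<open>finite P\<close> by (intro not2) auto
    then obtain p where "p \<in> P" "J p l" "ev p l (n - 3) \<notin> {a, b}" by blast
    then show ?thesis
      using evS[of p l "n - 3"] line[OF that] n3
      by (intro bexI[of _ "ev p l (n - 3)"]) (auto simp: Line_neighbours)
  qed
  show ?thesis
    unfolding confined_def
  proof (intro conjI ballI notI)
    have "S \<subseteq> (\<lambda>(p, l, i). ev p l i) ` (P \<times> L \<times> {..n - 2})"
      unfolding S_def by force
    then show "finite S"
      using assms(1,2) by (meson finite_SigmaI finite_atMost finite_imageI finite_subset)
  next
    fix v assume v: "v \<in> S"
    show "\<exists>a\<in>S. \<exists>b\<in>S. a \<noteq> b \<and> E v a \<and> E v b"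
    proof (cases v)
      case (Point p)
      then show ?thesis using v deg[of p] by (metis insertCI)
    next
      case (Line l)
      then show ?thesis using v deg'[of l] by (metis insertCI)
    next
      case (Mid p l i)
      note i = mid[OF v[unfolded Mid]]
      then have "E v (ev p l (i - 1))" "E v (ev p l (Suc i))"
        using E_ev'[of p l "i - 1"] E_ev[of p l i] Mid by auto
      moreover have "ev p l (i - 1) \<noteq> ev p l (Suc i)"
        using i by (auto simp: edge_vertex_def)
      moreover have "ev p l (i - 1) \<in> S" "ev p l (Suc i) \<in> S"
        using i by (auto intro!: evS)
      ultimately show ?thesis by blast
    qed
  next
    assume "\<exists>f. inj_on f {..<n - 2} \<and> f ` {..<n - 2} \<subseteq> S \<and> (\<forall>i. Suc i < n - 2 \<longrightarrow> E (f i) (f (Suc i))) \<and>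
      (\<forall>i<n - 2. \<exists>a b. \<forall>w\<in>S. E (f i) w \<longrightarrow> w \<in> {a, b})"
    then obtain f where f: "inj_on f {..<n - 2}" "\<And>i. i < n - 2 \<Longrightarrow> f i \<in> S"
      "\<And>i. Suc i < n - 2 \<Longrightarrow> E (f i) (f (Suc i))"
      "\<And>i. i < n - 2 \<Longrightarrow> \<exists>a b. \<forall>w\<in>S. E (f i) w \<longrightarrow> w \<in> {a, b}"
      by blast
    have f_mid: "\<exists>p l j. f i = Mid p l j" if "i < n - 2" for i
    proof (cases "f i")
      case (Point p)
      then show ?thesis using deg[of p] f(2,4)[OF that] by metis
    next
      case (Line l)
      then show ?thesis using deg'[of l] f(2,4)[OF that] by metis
    qed auto
    obtain p l j where f0: "f 0 = Mid p l j"
      using f_mid[of 0] n3 by auto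
    \<comment> \<open>Interior vertices of different flags are never adjacent.\<close>
    have "\<exists>j. f i = Mid p l j" if "i < n - 2" for i
      using that
    proof (induction i)
      case (Suc i)
      then obtain j where j: "f i = Mid p l j" by auto
      obtain p' l' j' where j': "f (Suc i) = Mid p' l' j'"
        using f_mid Suc by blast
      have "Mid p' l' j' \<in> {ev p l (j - 1), ev p l (Suc j)}"
        using Mid_neighbours[of p l j] f(3)[OF Suc.prems] j j' by auto
      then show ?case using j' by (auto simp: edge_vertex_def split: if_splits)
    qed (use f0 in auto)
    then have "f ` {..<n - 2} \<subseteq> Mid p l ` {1..<n - 2}"
      using f(2) mid by fastforce
    then have "card (f ` {..<n - 2}) \<le> card (Mid p l ` {1..<n - 2})"
      by (intro card_mono) auto
    then show False
      using f(1) n3 by (simp add: card_image inj_on_def)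
  qed
qed

text \<open>Every vertex lies on a subdivided flag, and the finite subspace around that flag yields
  a confined set.\<close>

lemma core_subdiv: "core n E = W"
proof
  show "core n E \<subseteq> W"
  proof
    fix s assume "s \<in> core n E"
    then obtain t where "E s t" by (auto simp: core_def confined_def)
    then show "s \<in> W" using ev_in_W by (auto elim!: E_cases)
  qed
  show "W \<subseteq> core n E"
  proof
    fix s assume "s \<in> W"
    have "\<exists>p l i. s = ev p l i \<and> J p l \<and> i \<le> n - 2"
    proof (cases s)
      case (Point p)
      then show ?thesis using point_on_line[of p] by (metis ev_0 le0)
    next
      case (Line l)
      then show ?thesis using line_has_point[of l] by (metis ev_last order_refl)
    next
      case (Mid p l i)
      then show ?thesis using \<open>s \<in> W\<close> by (intro exI[of _ p] exI[of _ l] exI[of _ i]) auto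
    qed
    then obtain p l i where s: "s = ev p l i" "J p l" "i \<le> n - 2" by blast
    from covered[OF s(2)] obtain P L where PL: "finite P" "finite L" "p \<in> P" "l \<in> L"
      "\<forall>q\<in>P. 3 \<le> card {k\<in>L. J q k}" "\<forall>k\<in>L. 3 \<le> card {q\<in>P. J q k}"
      by blast
    then have "confined n E {ev p l i | p l i. p \<in> P \<and> l \<in> L \<and> J p l \<and> i \<le> n - 2}"
      by (intro confined_flags) auto
    then show "s \<in> core n E"
      unfolding core_def using s PL by blast
  qed
qed

section \<open>Degrees and distances in the subdivision\<close>

lemma Point_degree: "infinite {t. E (Point p) t} \<longleftrightarrow> infinite {l. J p l}"
proof -
  have "{t. E (Point p) t} = (\<lambda>l. ev p l 1) ` {l. J p l}"
    by (auto simp: Point_neighbours)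
  moreover have "inj_on (\<lambda>l. ev p l 1) {l. J p l}"
    using n3 by (auto simp: inj_on_def ev_inj)
  ultimately show ?thesis by (simp add: finite_image_iff)
qed

lemma Line_degree: "finite {p. J p l} \<Longrightarrow> finite {t. E (Line l) t}"
  by (simp add: Line_neighbours)

lemma Mid_degree: "finite {t. E (Mid p l i) t}"
  by (rule finite_subset[of _ "{ev p l (i - 1), ev p l (Suc i)}"]) (use Mid_neighbours in auto)

text \<open>A vertex inside a flag is reached through its point or through its line. The invariant
  records from which one, how many flags were traversed to get there, at a cost of n - 2 each, and
  the rest of the way.\<close>

lemma subdiv_walk_imp:
  assumes "(E ^^ k) (Point a) z" "J p l" "i \<le> n - 2" "z = ev p l i"
  shows "(\<exists>m. m * (n - 2) + i \<le> k \<and> (incident J ^^ m) (Inl a) (Inl p)) \<or>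
    (\<exists>m. m * (n - 2) + (n - 2 - i) \<le> k \<and> (incident J ^^ m) (Inl a) (Inr l))"
proof -
  define D where "D k p l i \<longleftrightarrow> (\<exists>m. m * (n - 2) + i \<le> k \<and> (incident J ^^ m) (Inl a) (Inl p)) \<or>
    (\<exists>m. m * (n - 2) + (n - 2 - i) \<le> k \<and> (incident J ^^ m) (Inl a) (Inr l))" for k p l i
  have D_Point: "\<exists>m. m * (n - 2) \<le> k \<and> (incident J ^^ m) (Inl a) (Inl p)" if "D k p l 0" "J p l" for k p l
    using that(1) unfolding D_def
  proof (elim disjE exE conjE)
    fix m assume "m * (n - 2) + (n - 2 - 0) \<le> k" "(incident J ^^ m) (Inl a) (Inr l)"
    then have "Suc m * (n - 2) \<le> k" "(incident J ^^ Suc m) (Inl a) (Inl p)"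
      using that(2) by (auto simp: incident_def)
    then show ?thesis by blast
  qed auto
  have D_Line: "\<exists>m. m * (n - 2) \<le> k \<and> (incident J ^^ m) (Inl a) (Inr l)" if "D k p l (n - 2)" "J p l" for k p l
    using that(1) unfolding D_def
  proof (elim disjE exE conjE)
    fix m assume "m * (n - 2) + (n - 2) \<le> k" "(incident J ^^ m) (Inl a) (Inl p)"
    then have "Suc m * (n - 2) \<le> k" "(incident J ^^ Suc m) (Inl a) (Inr l)"
      using that(2) by (auto simp: incident_def)
    then show ?thesis by blast
  qed auto
  \<comment> \<open>A point is position 0 of all its flags and a line the last position of all its
    flags. The invariant must not depend on the flag chosen, because a walk may change flags
    there.\<close>
  have D_cong: "D k p' l' i'"
    if "D k p l i" "J p l" "J p' l'" "i \<le> n - 2" "i' \<le> n - 2" "ev p l i = ev p' l' i'" for k p l i p' l' i'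
  proof (cases "ev p' l' i'")
    case (Point q)
    with that have "i = 0" "i' = 0" "p = q" "p' = q"
      by (simp_all add: ev_eq)
    with D_Point[of k p l] that show ?thesis
      unfolding D_def[of k p' l' i'] by auto
  next
    case (Line q)
    with that have "i = n - 2" "i' = n - 2" "l = q" "l' = q"
      by (simp_all add: ev_eq)
    with D_Line[of k p l] that show ?thesis
      unfolding D_def[of k p' l' i'] by auto
  next
    case (Mid q r j)
    with that have "i = j" "i' = j" "l = r" "l' = r" "p = q" "p' = q"
      by (simp_all add: ev_eq)
    with that show ?thesis by simp
  qed
  have "D k p l i"
    using assms
  proof (induction k arbitrary: z p l i)
    case 0
    then have "i = 0" "p = a" using ev_eq_Point[of i p l a] by auto
    then show ?case unfolding D_def by auto
  next
    case (Suc k)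
    then obtain y where y: "(E ^^ k) (Point a) y" "E y z" by (auto elim: relpowp_Suc_E)
    from y(2) show ?case
    proof (cases rule: E_cases)
      case (1 q r j)
      then have "D k q r j" using Suc.IH[OF y(1)] by auto
      then have step: "D (Suc k) q r (Suc j)"
        unfolding D_def
      proof (elim disjE exE conjE)
        fix m assume "m * (n - 2) + j \<le> k" "(incident J ^^ m) (Inl a) (Inl q)"
        then show "(\<exists>m. m * (n - 2) + Suc j \<le> Suc k \<and> (incident J ^^ m) (Inl a) (Inl q)) \<or>
          (\<exists>m. m * (n - 2) + (n - 2 - Suc j) \<le> Suc k \<and> (incident J ^^ m) (Inl a) (Inr r))"
          by (intro disjI1 exI[of _ m]) auto
      next
        fix m assume "m * (n - 2) + (n - 2 - j) \<le> k" "(incident J ^^ m) (Inl a) (Inr r)"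
        then show "(\<exists>m. m * (n - 2) + Suc j \<le> Suc k \<and> (incident J ^^ m) (Inl a) (Inl q)) \<or>
          (\<exists>m. m * (n - 2) + (n - 2 - Suc j) \<le> Suc k \<and> (incident J ^^ m) (Inl a) (Inr r))"
          by (intro disjI2 exI[of _ m]) auto
      qed
      show ?thesis
        by (rule D_cong[OF step]) (use 1 Suc.prems in auto)
    next
      case (2 q r j)
      then have "D k q r (Suc j)" using Suc.IH[OF y(1)] by auto
      then have step: "D (Suc k) q r j"
        unfolding D_def
      proof (elim disjE exE conjE)
        fix m assume "m * (n - 2) + Suc j \<le> k" "(incident J ^^ m) (Inl a) (Inl q)"
        then show "(\<exists>m. m * (n - 2) + j \<le> Suc k \<and> (incident J ^^ m) (Inl a) (Inl q)) \<or>
          (\<exists>m. m * (n - 2) + (n - 2 - j) \<le> Suc k \<and> (incident J ^^ m) (Inl a) (Inr r))"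
          by (intro disjI1 exI[of _ m]) auto
      next
        fix m assume "m * (n - 2) + (n - 2 - Suc j) \<le> k" "(incident J ^^ m) (Inl a) (Inr r)"
        then show "(\<exists>m. m * (n - 2) + j \<le> Suc k \<and> (incident J ^^ m) (Inl a) (Inl q)) \<or>
          (\<exists>m. m * (n - 2) + (n - 2 - j) \<le> Suc k \<and> (incident J ^^ m) (Inl a) (Inr r))"
          using 2 by (intro disjI2 exI[of _ m]) auto
      qed
      show ?thesis
        by (rule D_cong[OF step]) (use 2 Suc.prems in auto)
    qed
  qed
  then show ?thesis unfolding D_def .
qed

text \<open>A walk of length at most 4 (n - 2) traverses at most four flags, and in the incidence
  graph four steps between points lead along line, point, line.\<close>

lemma short_walk_iff:
  "(\<exists>k \<le> 4 * (n - 2). (E ^^ k) (Point a) (Point b)) \<longleftrightarrow>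
    (\<exists>l x l'. J a l \<and> J x l \<and> J x l' \<and> J b l')"
proof
  assume "\<exists>k \<le> 4 * (n - 2). (E ^^ k) (Point a) (Point b)"
  then obtain k where k: "k \<le> 4 * (n - 2)" "(E ^^ k) (Point a) (Point b)" by blast
  \<comment> \<open>Any line through \<open>b\<close> serves to write \<open>Point b\<close> as a
    position on a flag.\<close>
  obtain l where l: "J b l" using point_on_line by blast
  have "Point b = ev b l 0" by simp
  from subdiv_walk_imp[OF k(2) l le0 this] obtain m where "m * (n - 2) \<le> k" "(incident J ^^ m) (Inl a) (Inl b)"
  proof (elim disjE exE conjE)
    fix m assume *: "m * (n - 2) + (n - 2 - 0) \<le> k" "(incident J ^^ m) (Inl a) (Inr l)"
    then have "Suc m * (n - 2) \<le> k" "(incident J ^^ Suc m) (Inl a) (Inl b)"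
      using l by (auto simp: incident_def)
    then show thesis using that by blast
  qed (use that in auto)
  then have m: "m * (n - 2) \<le> 4 * (n - 2)" "(incident J ^^ m) (Inl a) (Inl b)"
    using le_trans[OF _ k(1)] by blast+
  from m(1) have "m \<le> 4"
    by (rule mult_right_le_imp_le) (use n3 in simp)
  then have "m = 0 \<or> m = 1 \<or> m = 2 \<or> m = 3 \<or> m = 4" by auto
  \<comment> \<open>Incidence alternates between points and lines, which excludes odd
    \<open>m\<close>; walks of length 0 and 2 are padded by repetitions.\<close>
  then show "\<exists>l x l'. J a l \<and> J x l \<and> J x l' \<and> J b l'"
    using m(2) l by (elim disjE) (auto simp: incident_def eval_nat_numeral, blast+)
next
  assume "\<exists>l x l'. J a l \<and> J x l \<and> J x l' \<and> J b l'"
  then obtain l x l' where *: "J a l" "J x l" "J x l'" "J b l'" by blast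
  have go: "(E ^^ (n - 2)) (Point p) (Line k)" "(E ^^ (n - 2)) (Line k) (Point p)" if "J p k" for p k
  proof -
    have "(E ^^ (n - 2)) (ev p k 0) (ev p k (n - 2))"
      using E_ev[OF that] by (intro path_relpowp)
    then show "(E ^^ (n - 2)) (Point p) (Line k)" by simp
    then show "(E ^^ (n - 2)) (Line k) (Point p)" using E_sym by (rule relpowp_sym)
  qed
  have "(E ^^ ((n - 2) + (n - 2) + ((n - 2) + (n - 2)))) (Point a) (Point b)"
    unfolding relpowp_add using * go by blast
  then show "\<exists>k \<le> 4 * (n - 2). (E ^^ k) (Point a) (Point b)"
    by (intro exI[of _ "(n - 2) + (n - 2) + ((n - 2) + (n - 2))"]) auto
qed

end

section \<open>Coding graphs by linear spaces\<close>

text \<open>The type \<open>7\<close> is the ring of residues modulo 7. \<open>Fano u v i\<close>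
  and \<open>(u, v, j)\<close> are the points and lines of the plane of the ordered pair
  \<open>(u, v)\<close>; neither type depends on the graph, only the incidence of hubs does.\<close>

datatype point = Hub nat | Fano nat nat 7

type_synonym line = "nat \<times> nat \<times> 7"

instance point :: countable
  by countable_datatype

lemma fano_difference_set:
  fixes a b c d :: 7
  assumes "a \<in> {0,1,3}" "b \<in> {0,1,3}" "c \<in> {0,1,3}" "d \<in> {0,1,3}" "a - b = c - d" "a \<noteq> b"
  shows "a = c \<and> b = d"
  using assms by (auto)

text \<open>The Fano plane as the development of the perfect difference set \<open>{0, 1, 3}\<close> modulo 7.\<close>

definition fano :: "7 \<Rightarrow> 7 \<Rightarrow> bool" where
  "fano i j \<longleftrightarrow> j - i \<in> {0, 1, 3}"

primrec on_line :: "(nat \<Rightarrow> nat \<Rightarrow> bool) \<Rightarrow> point \<Rightarrow> line \<Rightarrow> bool" where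
  "on_line G (Hub w) l = (case l of (u, v, j) \<Rightarrow> w = u \<and> j = 0 \<or> w = v \<and> j = 1 \<and> G u v)"
| "on_line G (Fano u v i) l = (case l of (u', v', j) \<Rightarrow> u' = u \<and> v' = v \<and> fano i j)"

lemma three_lines: "\<exists>S. card S = 3 \<and> (\<forall>j\<in>S. fano i j)"
proof (intro exI conjI)
  show "card {i, i + 1, i + 3} = 3"
    by (simp add: card_insert_if)
qed (auto simp: fano_def)

lemma three_points: "\<exists>S. card S = 3 \<and> (\<forall>i\<in>S. fano i j)"
proof (intro exI conjI)
  show "card {j, j - 1, j - 3} = 3"
    by (simp add: card_insert_if algebra_simps)
qed (auto simp: fano_def)

text \<open>\<open>j - j'\<close> is the difference of \<open>j - i\<close> and
  \<open>j' - i\<close> and also of \<open>j - i'\<close> and \<open>j' - i'\<close>, and the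
  difference set represents a nonzero residue only once.\<close>

lemma fano_unique:
  assumes "fano i j" "fano i j'" "fano i' j" "fano i' j'"
  shows "i = i' \<or> j = j'"
  using fano_difference_set[of "j - i" "j' - i" "j - i'" "j' - i'"] assms by (auto simp: fano_def)

lemma fano_0_0: "fano 0 0" and fano_0_1: "fano 0 1"
  by (simp_all add: fano_def)

lemma on_line_unique:
  assumes "\<And>u. \<not> G u u" "on_line G p l" "on_line G p l'" "on_line G q l" "on_line G q l'"
  shows "p = q \<or> l = l'"
proof -
  obtain u v j u' v' j' where l: "l = (u, v, j)" "l' = (u', v', j')"
    by (cases l; cases l') auto
  have G: "G u u \<longleftrightarrow> False" for u using assms(1) by simp
  show ?thesis
  proof (cases p)
    case p: (Hub w)
    show ?thesis
    proof (cases q)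
      case (Hub w')
      then have "w = w'"
        using assms(2,4) p unfolding l by (simp add: G) (metis zero_neq_one)
      then show ?thesis using p Hub by simp
    next
      case (Fano w' z' i')
      then show ?thesis using assms(2-) p unfolding l by (simp add: G) (metis assms(1))
    qed
  next
    case p: (Fano w z i)
    show ?thesis
    proof (cases q)
      case (Hub w')
      then show ?thesis using assms(2-) p unfolding l by (simp add: G) (metis assms(1))
    next
      case (Fano w' z' i')
      with p show ?thesis
        using assms(2-) fano_unique[of i j j' i'] unfolding l by simp
    qed
  qed
qed

lemma hub_unique:
  assumes "\<And>u. \<not> G u u" "on_line G (Hub w) l" "on_line G (Hub w') l"
  shows "w = w'"
proof -
  obtain u v j where l: "l = (u, v, j)"
    by (cases l) auto
  show ?thesis
    using assms(2,3) unfolding l by simp (metis zero_neq_one)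
qed

text \<open>The middle point \<open>x\<close> cannot be a hub, as a line carries at most one. So it
  is a Fano point, both lines lie in its plane \<open>(s, t)\<close>, and two different hubs meet
  this plane only if \<open>s\<close> and \<open>t\<close> are adjacent.\<close>

lemma on_line_hub_path:
  assumes irrefl: "\<And>u. \<not> G u u" and sym: "\<And>u v. G u v \<Longrightarrow> G v u" and "u \<noteq> v"
  shows "(\<exists>a x b. on_line G (Hub u) a \<and> on_line G x a \<and> on_line G x b \<and> on_line G (Hub v) b) \<longleftrightarrow> G u v"
proof
  assume "G u v"
  then show "\<exists>a x b. on_line G (Hub u) a \<and> on_line G x a \<and> on_line G x b \<and> on_line G (Hub v) b"
    by (intro exI[of _ "(u, v, 0)"] exI[of _ "(u, v, 1)"] exI[of _ "Fano u v 0"])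
       (simp add: fano_0_0 fano_0_1)
next
  assume "\<exists>a x b. on_line G (Hub u) a \<and> on_line G x a \<and> on_line G x b \<and> on_line G (Hub v) b"
  then obtain a x b where *: "on_line G (Hub u) a" "on_line G x a" "on_line G x b" "on_line G (Hub v) b"
    by blast
  show "G u v"
  proof (cases x)
    case (Hub w)
    then have "u = w" "v = w"
      using * hub_unique[where G = G, OF irrefl] by blast+
    with \<open>u \<noteq> v\<close> show ?thesis by simp
  next
    case (Fano s t i)
    obtain j j' where ab: "a = (s, t, j)" "b = (s, t, j')"
      using * Fano by (cases a; cases b) auto
    have "u = s \<or> u = t \<and> G s t" "v = s \<or> v = t \<and> G s t"
      using *(1,4) unfolding ab by auto
    with \<open>u \<noteq> v\<close> sym show ?thesis by blast
  qed
qed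

lemma three_le_card: "card A = 3 \<Longrightarrow> A \<subseteq> B \<Longrightarrow> finite B \<Longrightarrow> 3 \<le> card B"
  by (metis card_mono)

text \<open>A Fano plane has three lines on each point and three points on each line. Only hubs need
  more than the plane of \<open>l\<close>.\<close>

lemma on_line_covered:
  assumes "on_line G p l"
  shows "\<exists>P L. finite P \<and> finite L \<and> p \<in> P \<and> l \<in> L \<and>
    (\<forall>q\<in>P. 3 \<le> card {k\<in>L. on_line G q k}) \<and> (\<forall>k\<in>L. 3 \<le> card {q\<in>P. on_line G q k})"
proof -
  obtain u v j where l: "l = (u, v, j)" by (cases l) auto
  \<comment> \<open>For a Fano point the default is hub 0. This extra hub satisfies the condition
    too, as its three planes belong to \<open>Z\<close>.\<close>
  define w where "w = (case p of Hub w \<Rightarrow> w | Fano _ _ _ \<Rightarrow> 0)"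
  \<comment> \<open>The lines of index 0 in the last three planes pass through \<open>Hub w\<close>,
    which gives the hub three lines whatever the edges of \<open>G\<close> are.\<close>
  define Z where "Z = {(u, v), (w, 0), (w, 1), (w, 2)}"
  define P where "P = insert (Hub w) ((\<lambda>((a, b), i). Fano a b i) ` (Z \<times> UNIV))"
  define L :: "line set" where "L = (\<lambda>((a, b), j). (a, b, j)) ` (Z \<times> UNIV)"
  have fin: "finite P" "finite L"
    unfolding P_def L_def Z_def by simp_all
  have inP: "Fano a b i \<in> P" and inL: "(a, b, j) \<in> L" if "(a, b) \<in> Z" for a b i j
    using that unfolding P_def L_def by force+
  have "3 \<le> card {k\<in>L. on_line G q k}" if q: "q \<in> P" for q
  proof (cases q)
    case (Hub z)
    with q have "z = w" unfolding P_def by auto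
    have "card {(w, 0 :: nat, 0), (w, 1, 0), (w, 2, 0 :: 7)} = 3" by simp
    moreover have "{(w, 0, 0), (w, 1, 0), (w, 2, 0)} \<subseteq> {k\<in>L. on_line G q k}"
      using Hub \<open>z = w\<close> inL by (auto simp: Z_def)
    ultimately show ?thesis
      by (rule three_le_card) (simp add: fin)
  next
    case (Fano a b i)
    with q have Z: "(a, b) \<in> Z" unfolding P_def by auto
    obtain S where S: "card S = 3" "\<forall>j\<in>S. fano i j" using three_lines by blast
    have "card ((\<lambda>j. (a, b, j)) ` S) = 3"
      using S(1) by (subst card_image) (auto simp: inj_on_def)
    moreover have "(\<lambda>j. (a, b, j)) ` S \<subseteq> {k\<in>L. on_line G q k}"
      using S(2) Fano inL[OF Z] by auto
    ultimately show ?thesis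
      by (rule three_le_card) (simp add: fin)
  qed
  moreover have "3 \<le> card {q\<in>P. on_line G q k}" if k: "k \<in> L" for k
  proof -
    obtain a b j where abj: "k = (a, b, j)" by (cases k) auto
    with k have Z: "(a, b) \<in> Z" unfolding L_def by auto
    obtain S where S: "card S = 3" "\<forall>i\<in>S. fano i j" using three_points by blast
    have "card ((\<lambda>i. Fano a b i) ` S) = 3"
      using S(1) by (subst card_image) (auto simp: inj_on_def)
    moreover have "(\<lambda>i. Fano a b i) ` S \<subseteq> {q\<in>P. on_line G q k}"
      using S(2) abj inP[OF Z] by auto
    ultimately show ?thesis
      by (rule three_le_card) (simp add: fin)
  qed
  moreover have "p \<in> P"
    using assms inP[of u v] unfolding l by (cases p) (auto simp: w_def P_def Z_def)
  moreover have "l \<in> L"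
    unfolding l by (rule inL) (simp add: Z_def)
  ultimately show ?thesis using fin by blast
qed

lemma hub_degree: "infinite {l. on_line G (Hub u) l}"
proof (rule infinite_super)
  show "range (\<lambda>v. (u, v, 0)) \<subseteq> {l. on_line G (Hub u) l}" by auto
  show "infinite (range (\<lambda>v::nat. (u, v, 0 :: 7)))"
    by (simp add: finite_image_iff inj_on_def)
qed

lemma fano_degree: "finite {l. on_line G (Fano u v i) l}"
  by (rule finite_subset[of _ "range (\<lambda>j. (u, v, j))"]) auto

lemma line_degree: "finite {p. on_line G p l}"
proof -
  obtain u v j where l: "l = (u, v, j)" by (cases l) auto
  have "p \<in> {Hub u, Hub v} \<union> range (Fano u v)" if "on_line G p l" for p
    using that unfolding l by (cases p) auto
  then have "{p. on_line G p l} \<subseteq> {Hub u, Hub v} \<union> range (Fano u v)" by blast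
  then show ?thesis by (rule finite_subset) simp
qed

lemma linear_space_on_line:
  assumes "3 \<le> n" "\<And>u. \<not> G u u"
  shows "linear_space n (on_line G)"
proof
  show "3 \<le> n" by fact
  show "\<And>p l l' q. on_line G p l \<Longrightarrow> on_line G p l' \<Longrightarrow> on_line G q l \<Longrightarrow> on_line G q l' \<Longrightarrow> p = q \<or> l = l'"
    using on_line_unique[where G = G, OF assms(2)] by blast
  show "\<exists>l. on_line G p l" for p
    using three_lines by (cases p) (auto simp: fano_def)
  show "\<exists>p. on_line G p l" for l
  proof -
    obtain u v j where "l = (u, v, j)" by (cases l) auto
    then have "on_line G (Fano u v j) l" by (simp add: fano_def)
    then show ?thesis by blast
  qed
qed (rule on_line_covered)

section \<open>Functoriality of the coding\<close>

primrec rename_point :: "(nat \<Rightarrow> nat) \<Rightarrow> point \<Rightarrow> point" where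
  "rename_point \<pi> (Hub w) = Hub (\<pi> w)"
| "rename_point \<pi> (Fano u v i) = Fano (\<pi> u) (\<pi> v) i"

fun rename_line :: "(nat \<Rightarrow> nat) \<Rightarrow> line \<Rightarrow> line" where
  "rename_line \<pi> (u, v, j) = (\<pi> u, \<pi> v, j)"

lemma on_line_rename:
  assumes "on_line G p l" "\<And>u v. G u v \<Longrightarrow> H (\<pi> u) (\<pi> v)"
  shows "on_line H (rename_point \<pi> p) (rename_line \<pi> l)"
  using assms by (cases p; cases l) auto

lemma subdiv_adjacent_map:
  assumes "subdiv_adjacent n J s t" "\<And>p l. J p l \<Longrightarrow> J' (f p) (g l)"
  shows "subdiv_adjacent n J' (map_subdiv f g s) (map_subdiv f g t)"
proof -
  have "map_subdiv f g (edge_vertex n p l i) = edge_vertex n (f p) (g l) i" for p l i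
    by (simp add: edge_vertex_def)
  then have "edge_step n J' (map_subdiv f g s) (map_subdiv f g t)" if "edge_step n J s t" for s t
    using that assms(2) unfolding edge_step_def by metis
  with assms(1) show ?thesis unfolding subdiv_adjacent_def by blast
qed

lemma subdiv_vertex_map:
  assumes "subdiv_vertex n J s" "\<And>p l. J p l \<Longrightarrow> J' (f p) (g l)"
  shows "subdiv_vertex n J' (map_subdiv f g s)"
  using assms by (cases s) auto

lemma subdiv_colour_map: "subdiv_colour n (map_subdiv f g s) = subdiv_colour n s"
  by (cases s) auto

lemma rename_inverse:
  assumes "\<And>x. \<tau> (\<pi> x) = x"
  shows "map_subdiv (rename_point \<tau>) (rename_line \<tau>) (map_subdiv (rename_point \<pi>) (rename_line \<pi>) s) = s"
proof -
  have "rename_point \<tau> (rename_point \<pi> p) = p" for p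
    using assms by (cases p) auto
  moreover have "rename_line \<tau> (rename_line \<pi> l) = l" for l
    using assms by (cases l) auto
  ultimately show ?thesis by (cases s) auto
qed

section \<open>The Borel reduction\<close>

abbreviation base_vertices :: "nat \<Rightarrow> (nat \<Rightarrow> nat \<Rightarrow> bool) \<Rightarrow> (point, line) subdiv set" where
  "base_vertices n G \<equiv> Collect (subdiv_vertex n (on_line G))"

abbreviation base_adjacent ::
  "nat \<Rightarrow> (nat \<Rightarrow> nat \<Rightarrow> bool) \<Rightarrow> (point, line) subdiv \<Rightarrow> (point, line) subdiv \<Rightarrow> bool" where
  "base_adjacent n G \<equiv> subdiv_adjacent n (on_line G)"

abbreviation vertices :: "nat \<Rightarrow> (nat \<Rightarrow> nat \<Rightarrow> bool) \<Rightarrow> (point, line) subdiv element set" where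
  "vertices n G \<equiv> completion n (subdiv_colour n) (base_vertices n G) (base_adjacent n G)"

definition codes :: "nat \<Rightarrow> (nat \<Rightarrow> nat \<Rightarrow> bool) \<Rightarrow> nat set" where
  "codes n G = to_nat ` vertices n G"

text \<open>Enumeration by increasing codes makes the bijection with the natural numbers explicit,
  so that it can be shown to be Borel in \<open>G\<close>.\<close>

definition nth_vertex :: "nat \<Rightarrow> (nat \<Rightarrow> nat \<Rightarrow> bool) \<Rightarrow> nat \<Rightarrow> (point, line) subdiv element" where
  "nth_vertex n G i = from_nat (enumerate (codes n G) i)"

definition polygon :: "nat \<Rightarrow> (nat \<Rightarrow> nat \<Rightarrow> bool) \<Rightarrow> geometry" where
  "polygon n G = (\<lambda>i. colour (subdiv_colour n) (nth_vertex n G i),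
     \<lambda>i. \<not> colour (subdiv_colour n) (nth_vertex n G i),
     \<lambda>i j. adjacent n (base_adjacent n G) (nth_vertex n G i) (nth_vertex n G j))"

lemma infinite_codes: "infinite (codes n G)"
proof -
  have "(Base \<circ> Point \<circ> Hub) u \<in> vertices n G" for u
    unfolding completion_def by (rule UN_I[of 0]) auto
  then have "range (Base \<circ> Point \<circ> Hub) \<subseteq> vertices n G"
    by blast
  moreover have "infinite (range (Base \<circ> Point \<circ> Hub :: nat \<Rightarrow> (point, line) subdiv element))"
    by (simp add: finite_image_iff inj_on_def)
  ultimately have "infinite (vertices n G)"
    by (rule infinite_super)
  then show ?thesis
    unfolding codes_def by (simp add: finite_image_iff inj_on_def)
qed

lemma bij_nth_vertex: "bij_betw (nth_vertex n G) UNIV (vertices n G)"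
proof -
  have "bij_betw (from_nat \<circ> enumerate (codes n G)) UNIV (vertices n G)"
  proof (rule bij_betw_trans)
    show "bij_betw (enumerate (codes n G)) UNIV (codes n G)"
      using infinite_codes by (rule bij_enumerate)
    show "bij_betw from_nat (codes n G) (vertices n G)"
      by (auto simp: bij_betw_def inj_on_def codes_def image_image)
  qed
  then show ?thesis
    by (simp add: nth_vertex_def[abs_def] comp_def)
qed

lemma partial_polygon_base:
  assumes "3 \<le> n" "G \<in> graphs"
  shows "linear_space n (on_line G)"
    and "partial_polygon n (subdiv_colour n) (base_vertices n G) (base_adjacent n G)"
proof -
  show *: "linear_space n (on_line G)"
    using assms by (intro linear_space_on_line) (auto simp: graphs_def irreflp_def)
  show "partial_polygon n (subdiv_colour n) (base_vertices n G) (base_adjacent n G)"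
    using * by (rule linear_space.partial_polygon)
qed

lemma polygon_in_generalised_polygons:
  assumes "3 \<le> n" "G \<in> graphs"
  shows "polygon n G \<in> generalised_polygons n"
  unfolding polygon_def
  by (rule partial_polygon.completion_polygon[OF partial_polygon_base(2)[OF assms] bij_nth_vertex])

text \<open>Removes the enumerations: isomorphisms may be sought between the completions
  themselves.\<close>

lemma geometry_iso_polygon_iff:
  "geometry_iso (polygon n G) (polygon n H) \<longleftrightarrow>
    (\<exists>h. bij_betw h (vertices n G) (vertices n H) \<and>
      (\<forall>s\<in>vertices n G. colour (subdiv_colour n) (h s) = colour (subdiv_colour n) s) \<and>
      (\<forall>s\<in>vertices n G. \<forall>t\<in>vertices n G.
         adjacent n (base_adjacent n H) (h s) (h t) = adjacent n (base_adjacent n G) s t))"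
proof
  let ?g = "nth_vertex n G" and ?h = "nth_vertex n H"
  define g' where "g' = the_inv_into UNIV ?g"
  define h' where "h' = the_inv_into UNIV ?h"
  note g = bij_nth_vertex[of n G] and h = bij_nth_vertex[of n H]
  have g': "bij_betw g' (vertices n G) UNIV" "\<And>s. s \<in> vertices n G \<Longrightarrow> ?g (g' s) = s"
    unfolding g'_def using g by (auto intro: bij_betw_the_inv_into f_the_inv_into_f_bij_betw)
  have h': "bij_betw h' (vertices n H) UNIV" "\<And>s. s \<in> vertices n H \<Longrightarrow> ?h (h' s) = s"
    unfolding h'_def using h by (auto intro: bij_betw_the_inv_into f_the_inv_into_f_bij_betw)
  {
    assume "geometry_iso (polygon n G) (polygon n H)"
    then obtain \<pi> where p: "bij \<pi>"
      "\<And>x. colour (subdiv_colour n) (?h (\<pi> x)) = colour (subdiv_colour n) (?g x)"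
      "\<And>x y. adjacent n (base_adjacent n H) (?h (\<pi> x)) (?h (\<pi> y)) = adjacent n (base_adjacent n G) (?g x) (?g y)"
      unfolding geometry_iso_def polygon_def by auto
    have "bij_betw (?h \<circ> (\<pi> \<circ> g')) (vertices n G) (vertices n H)"
      using p(1) g'(1) h by (intro bij_betw_trans)
    moreover have "colour (subdiv_colour n) ((?h \<circ> (\<pi> \<circ> g')) s) = colour (subdiv_colour n) s"
      if "s \<in> vertices n G" for s
      using p(2)[of "g' s"] g'(2) that by simp
    moreover have "adjacent n (base_adjacent n H) ((?h \<circ> (\<pi> \<circ> g')) s) ((?h \<circ> (\<pi> \<circ> g')) t) =
        adjacent n (base_adjacent n G) s t" if "s \<in> vertices n G" "t \<in> vertices n G" for s t
      using p(3)[of "g' s" "g' t"] g'(2) that by simp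
    ultimately show "\<exists>h. bij_betw h (vertices n G) (vertices n H) \<and>
      (\<forall>s\<in>vertices n G. colour (subdiv_colour n) (h s) = colour (subdiv_colour n) s) \<and>
      (\<forall>s\<in>vertices n G. \<forall>t\<in>vertices n G.
         adjacent n (base_adjacent n H) (h s) (h t) = adjacent n (base_adjacent n G) s t)"
      by blast
  next
    assume "\<exists>h. bij_betw h (vertices n G) (vertices n H) \<and>
      (\<forall>s\<in>vertices n G. colour (subdiv_colour n) (h s) = colour (subdiv_colour n) s) \<and>
      (\<forall>s\<in>vertices n G. \<forall>t\<in>vertices n G.
         adjacent n (base_adjacent n H) (h s) (h t) = adjacent n (base_adjacent n G) s t)"
    then obtain k where k: "bij_betw k (vertices n G) (vertices n H)"
      "\<And>s. s \<in> vertices n G \<Longrightarrow> colour (subdiv_colour n) (k s) = colour (subdiv_colour n) s"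
      "\<And>s t. s \<in> vertices n G \<Longrightarrow> t \<in> vertices n G \<Longrightarrow>
         adjacent n (base_adjacent n H) (k s) (k t) = adjacent n (base_adjacent n G) s t"
      by blast
    have bij: "bij_betw (h' \<circ> (k \<circ> ?g)) UNIV UNIV"
      using k(1) g h'(1) by (intro bij_betw_trans)
    have gG: "?g x \<in> vertices n G" for x using g by (auto simp: bij_betw_def)
    have kH: "k (?g x) \<in> vertices n H" for x using gG k(1) by (auto simp: bij_betw_def)
    show "geometry_iso (polygon n G) (polygon n H)"
      unfolding geometry_iso_def polygon_def prod.case
      by (rule exI[of _ "h' \<circ> (k \<circ> ?g)"]) (use bij h'(2)[OF kH] k(2)[OF gG] k(3)[OF gG gG] in simp)
  }
qed

section \<open>Isomorphism of graphs against isomorphism of polygons\<close>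

lemma graph_iso_imp_geometry_iso:
  assumes "3 \<le> n" "G \<in> graphs" "H \<in> graphs" "graph_iso G H"
  shows "geometry_iso (polygon n G) (polygon n H)"
proof -
  obtain \<pi> where p: "bij \<pi>" "\<And>x y. G x y = H (\<pi> x) (\<pi> y)"
    using assms(4) by (auto simp: graph_iso_def)
  define \<tau> where "\<tau> = inv \<pi>"
  have inv: "\<tau> (\<pi> x) = x" "\<pi> (\<tau> x) = x" for x
    using p(1) unfolding \<tau>_def by (simp_all add: bij_is_inj bij_is_surj surj_f_inv_f)
  have t: "H x y = G (\<tau> x) (\<tau> y)" for x y
    by (simp add: p(2) inv)
  define f where "f = map_subdiv (rename_point \<pi>) (rename_line \<pi>)"
  define g where "g = map_subdiv (rename_point \<tau>) (rename_line \<tau>)"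
  have onf: "on_line H (rename_point \<pi> p) (rename_line \<pi> l)" if "on_line G p l" for p l
    by (rule on_line_rename[OF that]) (simp add: p(2))
  have ong: "on_line G (rename_point \<tau> p) (rename_line \<tau> l)" if "on_line H p l" for p l
    by (rule on_line_rename[OF that]) (simp add: t)
  have f: "f a \<in> base_vertices n H \<and> g (f a) = a \<and> subdiv_colour n (f a) = subdiv_colour n a"
    if "a \<in> base_vertices n G" for a
    using that subdiv_vertex_map[of n "on_line G" a "on_line H"] onf rename_inverse[of \<tau> \<pi>, OF inv(1)]
    unfolding f_def g_def by (simp add: subdiv_colour_map)
  have g: "g a \<in> base_vertices n G \<and> f (g a) = a \<and> subdiv_colour n (g a) = subdiv_colour n a"
    if "a \<in> base_vertices n H" for a
    using that subdiv_vertex_map[of n "on_line H" a "on_line G"] ong rename_inverse[of \<pi> \<tau>, OF inv(2)]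
    unfolding f_def g_def by (simp add: subdiv_colour_map)
  have f': "base_adjacent n H (f a) (f b)" if "base_adjacent n G a b" for a b
    unfolding f_def using that onf by (rule subdiv_adjacent_map)
  have g': "base_adjacent n G (g a) (g b)" if "base_adjacent n H a b" for a b
    unfolding g_def using that ong by (rule subdiv_adjacent_map)
  note lift = lift_base_completion[where f = f and g = g,
      OF partial_polygon_base(2)[OF assms(1,2)] partial_polygon_base(2)[OF assms(1,3)] f f' g g']
  show ?thesis
    unfolding geometry_iso_polygon_iff
    by (rule exI[of _ "lift_base n f"]) (use lift in blast)
qed

lemma infinite_base_degree:
  assumes "3 \<le> n" "G \<in> graphs"
  shows "infinite {t. base_adjacent n G s t} \<longleftrightarrow> (\<exists>u. s = Point (Hub u))"
proof -
  interpret linear_space n "on_line G"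
    using assms by (rule partial_polygon_base)
  show ?thesis
  proof (cases s)
    case (Point p)
    then show ?thesis
      using Point_degree[of p] hub_degree fano_degree by (cases p) auto
  qed (use Line_degree[OF line_degree] Mid_degree in auto)
qed

lemma base_walk_iff:
  assumes "3 \<le> n" "G \<in> graphs"
  shows "G u v \<longleftrightarrow> u \<noteq> v \<and>
    (\<exists>k \<le> 4 * (n - 2). (base_adjacent n G ^^ k) (Point (Hub u)) (Point (Hub v)))"
proof -
  interpret linear_space n "on_line G"
    using assms by (rule partial_polygon_base)
  have "\<not> G x x" "G x y \<Longrightarrow> G y x" for x y
    using assms(2) by (auto simp: graphs_def irreflp_def dest: sympD)
  then show ?thesis
    unfolding short_walk_iff using on_line_hub_path[where G = G] by metis
qed

lemma geometry_iso_imp_graph_iso: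
  assumes "3 \<le> n" "G \<in> graphs" "H \<in> graphs" "geometry_iso (polygon n G) (polygon n H)"
  shows "graph_iso G H"
proof -
  interpret G: linear_space n "on_line G"
    using assms(1,2) by (rule partial_polygon_base)
  interpret H: linear_space n "on_line H"
    using assms(1,3) by (rule partial_polygon_base)
  interpret PG: partial_polygon n "subdiv_colour n" "base_vertices n G" "base_adjacent n G"
    by (rule G.partial_polygon)
  interpret PH: partial_polygon n "subdiv_colour n" "base_vertices n H" "base_adjacent n H"
    by (rule H.partial_polygon)
  obtain h where h: "bij_betw h (vertices n G) (vertices n H)"
    "\<And>s t. s \<in> vertices n G \<Longrightarrow> t \<in> vertices n G \<Longrightarrow> PH.adj (h s) (h t) = PG.adj s t"
    using assms(4) unfolding geometry_iso_polygon_iff by blast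
  \<comment> \<open>The core is defined from the graph alone, so \<open>h\<close> respects it; in
    both completions it is the copy of the base.\<close>
  have "h ` core n (induced PG.adj PG.F) = core n (induced PH.adj PH.F)"
    using h by (intro core_image[of h "vertices n G" "vertices n H"]) (auto simp: induced_def bij_betw_def)
  then have image: "h ` Base ` base_vertices n G = Base ` base_vertices n H"
    unfolding PG.core_completion PH.core_completion G.core_subdiv H.core_subdiv .
  have base: "Base a \<in> vertices n G" if "a \<in> base_vertices n G" for a
    using that by (auto simp: completion_def)
  define k where "k a = (case h (Base a) of Base b \<Rightarrow> b)" for a
  have hk: "h (Base a) = Base (k a)" if "a \<in> base_vertices n G" for a
  proof -
    have "h (Base a) \<in> Base ` base_vertices n H"
      unfolding image[symmetric] using that by blast
    then show ?thesis unfolding k_def by auto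
  qed
  have kW: "k ` base_vertices n G = base_vertices n H"
  proof -
    have "Base ` k ` base_vertices n G = Base ` base_vertices n H"
      unfolding image[symmetric] image_image using hk by (intro image_cong) simp_all
    then show ?thesis by (simp add: inj_image_eq_iff inj_on_def)
  qed
  have inj: "inj_on k (base_vertices n G)"
  proof (rule inj_onI)
    fix a b assume ab: "a \<in> base_vertices n G" "b \<in> base_vertices n G" "k a = k b"
    then have "h (Base a) = h (Base b)" by (simp add: hk)
    with h(1) base ab have "Base a = Base b" by (auto simp: bij_betw_def dest: inj_onD)
    then show "a = b" by simp
  qed
  have kE: "base_adjacent n H (k a) (k b) = base_adjacent n G a b"
    if "a \<in> base_vertices n G" "b \<in> base_vertices n G" for a b
    using h(2)[OF base[OF that(1)] base[OF that(2)]] hk that by simp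
  have inW: "a \<in> base_vertices n G \<and> b \<in> base_vertices n G" if "base_adjacent n G a b" for a b
    using that PG.in_W PG.sym by blast
  have inW': "a \<in> base_vertices n H \<and> b \<in> base_vertices n H" if "base_adjacent n H a b" for a b
    using that PH.in_W PH.sym by blast
  define k' where "k' = the_inv_into (base_vertices n G) k"
  have k'k: "k' (k a) = a" if "a \<in> base_vertices n G" for a
    unfolding k'_def using inj that by (rule the_inv_into_f_f)
  have nbrs: "{t. base_adjacent n H (k a) t} = k ` {t. base_adjacent n G a t}" if "a \<in> base_vertices n G" for a
  proof (intro set_eqI iffI)
    fix t assume "t \<in> {t. base_adjacent n H (k a) t}"
    then have t: "base_adjacent n H (k a) t" by simp
    then obtain b where "b \<in> base_vertices n G" "t = k b"
      using inW' kW by blast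
    with t that kE show "t \<in> k ` {t. base_adjacent n G a t}" by blast
  next
    fix t assume "t \<in> k ` {t. base_adjacent n G a t}"
    then show "t \<in> {t. base_adjacent n H (k a) t}" using inW kE by blast
  qed
  \<comment> \<open>Neighbours are counted in the base, where exactly the hubs have infinitely
    many.\<close>
  have degree: "(\<exists>u. k a = Point (Hub u)) \<longleftrightarrow> (\<exists>u. a = Point (Hub u))" if "a \<in> base_vertices n G" for a
  proof -
    have "inj_on k {t. base_adjacent n G a t}"
      using inj by (rule inj_on_subset) (use inW in blast)
    then have "infinite {t. base_adjacent n H (k a) t} \<longleftrightarrow> infinite {t. base_adjacent n G a t}"
      unfolding nbrs[OF that] by (simp add: finite_image_iff)
    then show ?thesis
      unfolding infinite_base_degree[OF assms(1,3)] infinite_base_degree[OF assms(1,2)] .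
  qed
  have hubW: "Point (Hub u) \<in> base_vertices n K" for u K by simp
  define r where "r u = (SOME v. k (Point (Hub u)) = Point (Hub v))" for u
  have r: "k (Point (Hub u)) = Point (Hub (r u))" for u
  proof -
    have "\<exists>v. k (Point (Hub u)) = Point (Hub v)"
      using degree[OF hubW[of u G]] by blast
    then show ?thesis unfolding r_def by (rule someI_ex)
  qed
  \<comment> \<open>Base edges join base vertices, so walks are carried over by \<open>k\<close> and
    by its inverse with their lengths, and the criterion for adjacency of hubs is preserved.\<close>
  have walk: "(base_adjacent n H ^^ m) (k a) (k b) \<longleftrightarrow> (base_adjacent n G ^^ m) a b"
    if "a \<in> base_vertices n G" "b \<in> base_vertices n G" for a b m
  proof
    assume "(base_adjacent n G ^^ m) a b"
    then show "(base_adjacent n H ^^ m) (k a) (k b)"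
      by (rule relpowp_map) (use inW kE in blast)
  next
    assume "(base_adjacent n H ^^ m) (k a) (k b)"
    then have "(base_adjacent n G ^^ m) (k' (k a)) (k' (k b))"
    proof (rule relpowp_map)
      fix x y assume xy: "base_adjacent n H x y"
      then obtain a b where "a \<in> base_vertices n G" "b \<in> base_vertices n G" "x = k a" "y = k b"
        using inW' kW by blast
      with xy kE k'k show "base_adjacent n G (k' x) (k' y)" by simp
    qed
    then show "(base_adjacent n G ^^ m) a b" using k'k that by simp
  qed
  have "inj r"
  proof (rule injI)
    fix u v assume "r u = r v"
    then have "k (Point (Hub u)) = k (Point (Hub v))" by (simp add: r)
    then have "(Point (Hub u) :: (point, line) subdiv) = Point (Hub v)"
      using inj_onD[OF inj _ hubW hubW] by blast
    then show "u = v" by simp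
  qed
  moreover have "\<exists>u. r u = v" for v
  proof -
    have "Point (Hub v) \<in> k ` base_vertices n G"
      unfolding kW by (rule hubW)
    then obtain a where a: "a \<in> base_vertices n G" "k a = Point (Hub v)" by (metis imageE)
    with degree obtain u where "a = Point (Hub u)" by blast
    with a r show ?thesis by (metis point.inject(1) subdiv.inject(1))
  qed
  ultimately have "bij r"
    unfolding bij_def surj_def by metis
  moreover have "G u v = H (r u) (r v)" for u v
  proof -
    have "r u = r v \<longleftrightarrow> u = v" using \<open>inj r\<close> by (simp add: inj_eq)
    moreover note walk[OF hubW[of u G] hubW[of v G], unfolded r]
    ultimately show ?thesis
      using base_walk_iff[OF assms(1,2), of u v] base_walk_iff[OF assms(1,3), of "r u" "r v"] by presburger
  qed
  ultimately show ?thesis unfolding graph_iso_def by blast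
qed

section \<open>Measurability of the reduction\<close>

lemma pred_edge [measurable]: "Measurable.pred borel (\<lambda>G :: nat \<Rightarrow> nat \<Rightarrow> bool. G u v)"
proof -
  have "continuous_on UNIV (\<lambda>G :: nat \<Rightarrow> nat \<Rightarrow> bool. G u v)"
    by (intro continuous_on_product_then_coordinatewise[OF
        continuous_on_product_then_coordinatewise[where f = "\<lambda>G. G"]] continuous_intros)
  from open_vimage[OF open_discrete this, of "{True}"] show ?thesis
    by (simp add: pred_def vimage_def borel_open)
qed

lemma pred_on_line [measurable]: "Measurable.pred borel (\<lambda>G. on_line G p l)"
  by (cases p; cases l) simp_all

lemma pred_subdiv_vertex [measurable]: "Measurable.pred borel (\<lambda>G. subdiv_vertex n (on_line G) s)"
  by (cases s) simp_all

lemma pred_subdiv_adjacent [measurable]: "Measurable.pred borel (\<lambda>G. subdiv_adjacent n (on_line G) s t)"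
  unfolding subdiv_adjacent_def edge_step_def by measurable

lemma pred_adjacent [measurable]:
  "Measurable.pred borel (\<lambda>G. adjacent n (subdiv_adjacent n (on_line G)) s t)"
  unfolding adjacent_def by measurable

text \<open>The relation for \<open>Suc m\<close> is a countable union over the last vertex but
  one.\<close>

lemma pred_relpowp:
  fixes R :: "'b \<Rightarrow> 'a::countable \<Rightarrow> 'a \<Rightarrow> bool"
  assumes [measurable]: "\<And>x y. Measurable.pred M (\<lambda>G. R G x y)"
  shows "Measurable.pred M (\<lambda>G. (R G ^^ m) x y)"
proof (induction m arbitrary: y)
  case (Suc m)
  note [measurable] = Suc
  show ?case by (simp add: OO_def)
qed simp

text \<open>A stage is defined from the previous one with quantifiers over countable types only, so
  membership of a fixed term remains Borel in \<open>G\<close>.\<close>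

lemma pred_stage:
  "Measurable.pred borel (\<lambda>G. t \<in> stage n (subdiv_colour n) (Collect (subdiv_vertex n (on_line G)))
     (subdiv_adjacent n (on_line G)) k)"
proof (induction k arbitrary: t)
  case 0
  have "t \<in> Base ` Collect P \<longleftrightarrow> (\<exists>a. t = Base a \<and> P a)" for P :: "(point, line) subdiv \<Rightarrow> bool"
    by auto
  then show ?case by simp
next
  case (Suc k)
  note [measurable] = Suc
  have [measurable]: "Measurable.pred borel (\<lambda>G. (induced (adjacent n (subdiv_adjacent n (on_line G)))
     (stage n (subdiv_colour n) (Collect (subdiv_vertex n (on_line G))) (subdiv_adjacent n (on_line G)) k) ^^ m) x y)"
    for m x y
    by (rule pred_relpowp) (simp add: induced_def)
  show ?case
    unfolding stage.simps Un_iff mem_Collect_eq joinable_def by measurable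
qed

lemma pred_vertices [measurable]: "Measurable.pred borel (\<lambda>G. t \<in> vertices n G)"
proof -
  note pred_stage[measurable]
  show ?thesis
    unfolding completion_def UN_iff by measurable
qed

lemma measurable_enumerate_codes [measurable]:
  "(\<lambda>G. enumerate (codes n G) i) \<in> borel \<rightarrow>\<^sub>M count_space UNIV"
proof (induction i)
  have [measurable]: "Measurable.pred borel (\<lambda>G. k \<in> codes n G)" for k
  proof -
    have "k \<in> codes n G \<longleftrightarrow> (\<exists>t. k = to_nat t \<and> t \<in> vertices n G)" for G
      by (auto simp: codes_def)
    then show ?thesis by simp
  qed
  {
    case 0
    show ?case unfolding enumerate_0 by measurable
  next
    case (Suc i)
    note [measurable] = Suc
    \<comment> \<open>The next code is the least one above the current code, and a least natural
      number with a Borel property is a Borel function of \<open>G\<close>.\<close>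
    show ?case unfolding enumerate_Suc''[OF infinite_codes] by measurable
  }
qed

lemma measurable_nth_vertex [measurable]: "(\<lambda>G. nth_vertex n G i) \<in> borel \<rightarrow>\<^sub>M count_space UNIV"
  unfolding nth_vertex_def by measurable

text \<open>With second countable factors the Borel sets of the countable products are generated by
  the coordinates, so measurability may be checked coordinatewise.\<close>

instance bool :: second_countable_topology
proof
  show "\<exists>B :: bool set set. countable B \<and> open = generate_topology B"
    by (intro exI[of _ UNIV]) (auto simp: fun_eq_iff open_discrete intro: generate_topology.Basis)
qed

lemma borel_bool_if_pred: "Measurable.pred M P \<Longrightarrow> P \<in> M \<rightarrow>\<^sub>M (borel :: bool measure)"
  by (simp add: measurable_def)

lemma borel_measurable_polygon: "polygon n \<in> borel_measurable borel"
proof -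
  have vertex: "Measurable.pred borel (\<lambda>G. Q (nth_vertex n G i))" for Q i
    by measurable
  have adj: "Measurable.pred borel (\<lambda>G. adjacent n (base_adjacent n G) (nth_vertex n G i) (nth_vertex n G j))" for i j
  proof -
    \<comment> \<open>Both the relation and its arguments vary with \<open>G\<close>. Splitting over
      the countably many values of the arguments reduces this to fixed terms.\<close>
    have "adjacent n (base_adjacent n G) (nth_vertex n G i) (nth_vertex n G j) \<longleftrightarrow>
      (\<exists>s t. nth_vertex n G i = s \<and> nth_vertex n G j = t \<and> adjacent n (base_adjacent n G) s t)" for G
      by blast
    moreover have "Measurable.pred borel (\<lambda>G. \<exists>s t. nth_vertex n G i = s \<and> nth_vertex n G j = t \<and>
        adjacent n (base_adjacent n G) s t)"
      by measurable
    ultimately show ?thesis by simp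
  qed
  show ?thesis
    unfolding polygon_def[abs_def]
    by (intro borel_measurable_Pair measurable_coordinatewise_then_product borel_bool_if_pred vertex adj)
qed

theorem theorem3p10:
  fixes n :: nat
  assumes "3 \<le> n"
  shows "borel_complete (generalised_polygons n) geometry_iso"
  unfolding borel_complete_def borel_reducible_def
proof (rule bexI[of _ "polygon n"])
  show "\<forall>G\<in>graphs. \<forall>H\<in>graphs. graph_iso G H = geometry_iso (polygon n G) (polygon n H)"
    using graph_iso_imp_geometry_iso geometry_iso_imp_graph_iso assms by blast
  show "polygon n \<in> restrict_space borel graphs \<rightarrow>\<^sub>M restrict_space borel (generalised_polygons n)"
    using polygon_in_generalised_polygons[OF assms] borel_measurable_polygon
    by (intro measurable_restrict_space2 measurable_restrict_space1) (auto simp: space_restrict_space)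
qed

end
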